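(* For every Coxeter graph $\Gamma$, there is a cellular isomorphism between the two CW-complexes $\overline{\Sigma}(\Gamma)$ and $\overline{\Omega}(\Gamma)$.
   Context: Let $S$ be a countable set. A Coxeter graph $\Gamma$ on $S$ encodes a symmetric matrix $(m_{s,t})_{s,t\in S}$ with $m_{s,s}=1$ and $m_{s,t}\in\{2,3,\dots\}\cup\{\infty\}$ for $s\neq t$. Its Coxeter group is $W=W[\Gamma]=\langle S\mid s^2=1\ (s\in S),\ (st)^{m_{s,t}}=1\ (s\neq t,\ m_{s,t}\neq\infty)\rangle$. Let $V=\bigoplus_{s\in S}\mathbb{R}\alpha_s$ with the symmetric bilinear form $\langle\alpha_s,\alpha_t\rangle=-\cos(\pi/m_{s,t})$ if $m_{s,t}\neq\infty$ and $-1$ otherwise. $W$ acts faithfully on $V$, preserving the form, by $s(v)=v-2\langle\alpha_s,v\rangle\alpha_s$. The root system is $\Phi[\Gamma]=\{w(\alpha_s): w\in W,s\in S\}$. For $\beta=w(\alpha_s)\in\Phi[\Gamma]$ put $r_\beta=wsw^{-1}$ (well defined). A subset $\mathcal{X}\subset\Phi[\Gamma]$ is almost parabolic (AP) if its vectors are linearly independent and for all $\beta,\gamma\in\mathcal{X}$ there exist $w\in W$ and $s,t\in S$ with $\beta=w(\alpha_s)$ and $\gamma=w(\alpha_t)$. Put $R_{\mathcal{X}}=\{r_\beta:\beta\in\mathcal{X}\}$ and $W_{\mathcal{X}}=\langle R_{\mathcal{X}}\rangle$; $\mathcal{X}$ is of spherical type if $W_{\mathcal{X}}$ is finite. For $\mathcal{X}$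 AP, $(W_{\mathcal{X}},R_{\mathcal{X}})$ is a Coxeter system. Let $\mathcal{R}^f$ be the set of all AP subsets of spherical type (including $\emptyset$). For $\mathcal{Y}\subset\mathcal{X}\in\mathcal{R}^f$, an element $u\in W_{\mathcal{X}}$ is $(\emptyset,R_{\mathcal{Y}})$-minimal if it has minimal length with respect to $R_{\mathcal{X}}$ in $uW_{\mathcal{Y}}$; then $u(\mathcal{Y})\in\mathcal{R}^f$. For $\mathcal{X}\in\mathcal{R}^f$ let $V_{\mathcal{X}}=\mathrm{span}(\mathcal{X})$ (on which the form is positive definite), let $\{\beta^*_{\mathcal{X}}:\beta\in\mathcal{X}\}\subset V_{\mathcal{X}}$ be the basis dual to $\mathcal{X}$, $o_{\mathcal{X}}=\sum_{\beta\in\mathcal{X}}\beta^*_{\mathcal{X}}$, and $C[\mathcal{X}]=\mathrm{conv}\{z(o_{\mathcal{X}}): z\in W_{\mathcal{X}}\}$ (with $C[\emptyset]=\{0\}$). Its faces are $F(u,\mathcal{Y},\mathcal{X})=\mathrm{conv}\{uz(o_{\mathcal{X}}): z\in W_{\mathcal{Y}}\}$ for $\mathcal{Y}\subset\mathcal{X}$ and $u\in W_{\mathcal{X}}$ $(\emptyset,R_{\mathcal{Y}})$-minimal. $\overline{\Sigma}(\Gamma)$ and $\overline{\Omega}(\Gamma)$ are CW-complexes (weak topology, built inductively on skeleta), each with exactly one $k$-cell for each pair $(z,\mathcal{X})$ with $z\in W$, $\mathcal{X}\in\mathcal{R}^f$, $|\mathcal{X}|=k$, modelled on a separate copy of $C[\mathcal{X}]$.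 Their characteristic maps $\overline\phi_{z,\mathcal{X}}:C[\mathcal{X}]\to\overline\Sigma(\Gamma)$ and $\overline\Lambda_{z,\mathcal{X}}:C[\mathcal{X}]\to\overline\Omega(\Gamma)$ satisfy, for $x$ in a proper face $F(u,\mathcal{Y},\mathcal{X})$ ($\mathcal{Y}\subsetneq\mathcal{X}$, $u\in W_{\mathcal{X}}$ $(\emptyset,R_{\mathcal{Y}})$-minimal): $$\overline\phi_{z,\mathcal{X}}(x)=\overline\phi_{zu,\mathcal{Y}}\big(u^{-1}(x)+o_{\mathcal{Y}}-o_{\mathcal{X}}\big),\qquad \overline\Lambda_{z,\mathcal{X}}(x)=\overline\Lambda_{zu^{-1},u(\mathcal{Y})}\big(x+u(o_{\mathcal{Y}}-o_{\mathcal{X}})\big),$$ where the translation by $u(o_{\mathcal{Y}}-o_{\mathcal{X}})$ maps $F(u,\mathcal{Y},\mathcal{X})$ onto $C[u(\mathcal{Y})]$; these prescriptions are compatible on intersections of faces. *)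

theory Defs
  imports
    "HOL-Analysis.Analysis"
    "HOL-Analysis.Finite_Function_Topology"
    "HOL-Algebra.Generated_Groups"
    "HOL-Library.Extended_Nat"
begin

section \<open>Groups given by a presentation\<close>

text \<open>A letter \<open>(x, True)\<close> stands for the generator \<open>x\<close> and \<open>(x, False)\<close> for its formal inverse.\<close>

type_synonym 'a word = "('a \<times> bool) list"

definition words :: "'a set \<Rightarrow> 'a word set" where
  "words X = lists (X \<times> UNIV)"

inductive_set pres_rel :: "'a set \<Rightarrow> 'a word set \<Rightarrow> ('a word \<times> 'a word) set"
  for X :: "'a set" and R :: "'a word set" where
  refl: "w \<in> words X \<Longrightarrow> (w, w) \<in> pres_rel X R"
| sym: "(v, w) \<in> pres_rel X R \<Longrightarrow> (w, v) \<in> pres_rel X R"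
| trans: "(u, v) \<in> pres_rel X R \<Longrightarrow> (v, w) \<in> pres_rel X R \<Longrightarrow> (u, w) \<in> pres_rel X R"
| congr: "(v, w) \<in> pres_rel X R \<Longrightarrow> a \<in> words X \<Longrightarrow> b \<in> words X
    \<Longrightarrow> (a @ v @ b, a @ w @ b) \<in> pres_rel X R"
| cancel: "x \<in> X \<Longrightarrow> ([(x, e), (x, \<not> e)], []) \<in> pres_rel X R"
| relator: "r \<in> R \<Longrightarrow> r \<in> words X \<Longrightarrow> (r, []) \<in> pres_rel X R"

text \<open>The group \<open>\<langle>X | r = 1 (r \<in> R)\<rangle>\<close>, with equivalence classes of words as elements.\<close>

definition presented_group :: "'a set \<Rightarrow> 'a word set \<Rightarrow> 'a word set monoid" where
  "presented_group X R =
    \<lparr> carrier = words X // pres_rel X R,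
      mult = (\<lambda>A B. \<Union>a\<in>A. \<Union>b\<in>B. pres_rel X R `` {a @ b}),
      one = pres_rel X R `` {[]} \<rparr>"

definition word_length_in :: "('g, 'b) monoid_scheme \<Rightarrow> 'g set \<Rightarrow> 'g \<Rightarrow> nat" where
  "word_length_in G R g =
    (LEAST n. \<exists>rs. set rs \<subseteq> R \<and> length rs = n \<and> foldr (\<lambda>a b. a \<otimes>\<^bsub>G\<^esub> b) rs \<one>\<^bsub>G\<^esub> = g)"


section \<open>Complexes glued from cells\<close>

record ('p, 'i, 'v) cell_complex =
  total_space :: "'p topology"
  cells :: "'i set"
  cell_dim :: "'i \<Rightarrow> nat"
  model :: "'i \<Rightarrow> 'v set"
  char_map :: "'i \<Rightarrow> 'v \<Rightarrow> 'p"

definition skeleton :: "('p, 'i, 'v) cell_complex \<Rightarrow> nat \<Rightarrow> 'p set" where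
  "skeleton K n = (\<Union>i\<in>{i \<in> cells K. cell_dim K i \<le> n}. char_map K i ` model K i)"

definition open_cell :: "('p, 'i, 'v::real_normed_vector) cell_complex \<Rightarrow> 'i \<Rightarrow> 'p set" where
  "open_cell K i = char_map K i ` rel_interior (model K i)"

definition cellular_isomorphism ::
  "('p, 'i, 'v::real_normed_vector) cell_complex \<Rightarrow> ('q, 'j, 'w::real_normed_vector) cell_complex
    \<Rightarrow> ('p \<Rightarrow> 'q) \<Rightarrow> bool" where
  "cellular_isomorphism K L f \<longleftrightarrow>
    homeomorphic_map (total_space K) (total_space L) f \<and>
    (\<forall>n. f ` skeleton K n = skeleton L n) \<and>
    (\<exists>\<sigma>. bij_betw \<sigma> (cells K) (cells L) \<and>
      (\<forall>i\<in>cells K. cell_dim L (\<sigma> i) = cell_dim K i \<and> f ` open_cell K i = open_cell L (\<sigma> i)))"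

text \<open>
  Attaching cells one skeleton at a time, when the attaching maps are prescribed on the faces of the
  models by passing to points of lower-dimensional models, amounts to taking the quotient of the
  disjoint union \<open>Sigma I D\<close> of all models by the equivalence relation generated by these
  prescriptions \<open>G\<close>; the quotient topology is the weak topology with respect to the cells.
\<close>

definition glue_rel :: "'i set \<Rightarrow> ('i \<Rightarrow> 'v set) \<Rightarrow> (('i \<times> 'v) \<times> ('i \<times> 'v)) set
    \<Rightarrow> (('i \<times> 'v) \<times> ('i \<times> 'v)) set" where
  "glue_rel I D G = ((G \<union> G\<inverse>) \<inter> Sigma I D \<times> Sigma I D)\<^sup>*"

definition glue_open :: "'i set \<Rightarrow> ('i \<Rightarrow> 'v::topological_space set)
    \<Rightarrow> (('i \<times> 'v) \<times> ('i \<times> 'v)) set \<Rightarrow> ('i \<times> 'v) set set \<Rightarrow> bool" where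
  "glue_open I D G U \<longleftrightarrow> U \<subseteq> Sigma I D // glue_rel I D G \<and>
    (\<forall>i\<in>I. openin (top_of_set (D i)) {x \<in> D i. glue_rel I D G `` {(i, x)} \<in> U})"

lemma istopology_glue_open: "istopology (glue_open I D G)"
  unfolding istopology_def
proof (intro conjI allI impI)
  fix U V assume U: "glue_open I D G U" and V: "glue_open I D G V"
  have "openin (top_of_set (D i)) {x \<in> D i. glue_rel I D G `` {(i, x)} \<in> U \<inter> V}" if "i \<in> I" for i
  proof -
    have "{x \<in> D i. glue_rel I D G `` {(i, x)} \<in> U \<inter> V}
        = {x \<in> D i. glue_rel I D G `` {(i, x)} \<in> U} \<inter> {x \<in> D i. glue_rel I D G `` {(i, x)} \<in> V}"
      by blast
    with U V that show ?thesis by (simp add: glue_open_def openin_Int)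
  qed
  with U V show "glue_open I D G (U \<inter> V)" by (auto simp: glue_open_def)
next
  fix \<U> assume \<U>: "\<forall>U\<in>\<U>. glue_open I D G U"
  have "openin (top_of_set (D i)) {x \<in> D i. glue_rel I D G `` {(i, x)} \<in> \<Union>\<U>}" if "i \<in> I" for i
  proof -
    have "{x \<in> D i. glue_rel I D G `` {(i, x)} \<in> \<Union>\<U>}
        = (\<Union>U\<in>\<U>. {x \<in> D i. glue_rel I D G `` {(i, x)} \<in> U})"
      by blast
    with \<U> that show ?thesis by (auto simp: glue_open_def intro!: openin_Union)
  qed
  with \<U> show "glue_open I D G (\<Union>\<U>)" by (auto simp: glue_open_def)
qed

definition glued_complex :: "'i set \<Rightarrow> ('i \<Rightarrow> nat) \<Rightarrow> ('i \<Rightarrow> 'v::topological_space set)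
    \<Rightarrow> (('i \<times> 'v) \<times> ('i \<times> 'v)) set \<Rightarrow> (('i \<times> 'v) set, 'i, 'v) cell_complex" where
  "glued_complex I d D G =
    \<lparr> total_space = topology (glue_open I D G),
      cells = I,
      cell_dim = d,
      model = D,
      char_map = (\<lambda>i x. glue_rel I D G `` {(i, x)}) \<rparr>"


section \<open>Coxeter groups and almost parabolic sets of roots\<close>

locale coxeter_graph =
  fixes S :: "'s set" and m :: "'s \<Rightarrow> 's \<Rightarrow> enat"
  assumes countable_S: "countable S"
    and m_diag: "s \<in> S \<Longrightarrow> m s s = 1"
    and m_sym: "s \<in> S \<Longrightarrow> t \<in> S \<Longrightarrow> m s t = m t s"
    and m_ge_2: "s \<in> S \<Longrightarrow> t \<in> S \<Longrightarrow> s \<noteq> t \<Longrightarrow> 2 \<le> m s t"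
begin

definition coxeter_relators :: "'s word set" where
  "coxeter_relators =
    {[(s, True), (s, True)] | s. s \<in> S} \<union>
    {concat (replicate k [(s, True), (t, True)]) | s t k. s \<in> S \<and> t \<in> S \<and> s \<noteq> t \<and> m s t = enat k}"

definition W :: "'s word set monoid" where
  "W = presented_group S coxeter_relators"

definition gen :: "'s \<Rightarrow> 's word set" where
  "gen s = pres_rel S coxeter_relators `` {[(s, True)]}"

text \<open>
  \<open>V\<close> is the set of finitely supported functions \<open>'s \<Rightarrow>\<^sub>0 real\<close> with support in \<open>S\<close>. Everything below
  is built from the simple roots \<open>\<alpha> s\<close> with \<open>s \<in> S\<close> and hence lies in \<open>V\<close>. The topology of
  \<open>'s \<Rightarrow>\<^sub>0 real\<close> is that of the \<open>\<ell>\<^sup>1\<close>-norm; only its restriction to finite-dimensional subspaces matters,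
  and that restriction is the usual Euclidean one.
\<close>

definition \<alpha> :: "'s \<Rightarrow> 's \<Rightarrow>\<^sub>0 real" where
  "\<alpha> s = Poly_Mapping.single s 1"

definition form_coeff :: "'s \<Rightarrow> 's \<Rightarrow> real" where
  "form_coeff s t = (case m s t of enat k \<Rightarrow> - cos (pi / real k) | \<infinity> \<Rightarrow> - 1)"

definition form :: "('s \<Rightarrow>\<^sub>0 real) \<Rightarrow> ('s \<Rightarrow>\<^sub>0 real) \<Rightarrow> real" where
  "form v w = (\<Sum>s\<in>Poly_Mapping.keys v. \<Sum>t\<in>Poly_Mapping.keys w.
     Poly_Mapping.lookup v s * Poly_Mapping.lookup w t * form_coeff s t)"

definition simple_reflection :: "'s \<Rightarrow> ('s \<Rightarrow>\<^sub>0 real) \<Rightarrow> ('s \<Rightarrow>\<^sub>0 real)" where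
  "simple_reflection s v = v - (2 * form (\<alpha> s) v) *\<^sub>R \<alpha> s"

text \<open>
  The formal inverse of a generator acts like the generator itself, reflections being involutions.
  The action of an element of \<open>W\<close> does not depend on the word chosen to represent it.
\<close>

definition act :: "'s word set \<Rightarrow> ('s \<Rightarrow>\<^sub>0 real) \<Rightarrow> ('s \<Rightarrow>\<^sub>0 real)" where
  "act w v = foldr (\<lambda>(s, e). simple_reflection s) (SOME u. u \<in> w) v"

definition roots :: "('s \<Rightarrow>\<^sub>0 real) set" where
  "roots = {act w (\<alpha> s) | w s. w \<in> carrier W \<and> s \<in> S}"

definition almost_parabolic :: "('s \<Rightarrow>\<^sub>0 real) set \<Rightarrow> bool" where
  "almost_parabolic X \<longleftrightarrow> X \<subseteq> roots \<and> independent X \<and>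
    (\<forall>\<beta>\<in>X. \<forall>\<gamma>\<in>X. \<exists>w\<in>carrier W. \<exists>s\<in>S. \<exists>t\<in>S. \<beta> = act w (\<alpha> s) \<and> \<gamma> = act w (\<alpha> t))"

text \<open>
  The reflection \<open>r\<^sub>\<beta> = w s w\<inverse>\<close> is attached to \<open>\<beta> = w(\<alpha>\<^sub>s)\<close>; since it depends only on \<open>\<beta>\<close>, the set
  of the reflections of \<open>X\<close> is obtained by letting \<open>(w, s)\<close> range over all ways of writing its elements.
\<close>

definition R :: "('s \<Rightarrow>\<^sub>0 real) set \<Rightarrow> 's word set set" where
  "R X = {w \<otimes>\<^bsub>W\<^esub> gen s \<otimes>\<^bsub>W\<^esub> inv\<^bsub>W\<^esub> w | w s. w \<in> carrier W \<and> s \<in> S \<and> act w (\<alpha> s) \<in> X}"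

definition W_sub :: "('s \<Rightarrow>\<^sub>0 real) set \<Rightarrow> 's word set set" where
  "W_sub X = generate W (R X)"

definition Rf :: "('s \<Rightarrow>\<^sub>0 real) set set" where
  "Rf = {X. almost_parabolic X \<and> finite (W_sub X)}"

text \<open>\<open>u\<close> is \<open>(\<emptyset>, R\<^sub>Y)\<close>-minimal in \<open>W\<^sub>X\<close>.\<close>

definition minimal :: "('s \<Rightarrow>\<^sub>0 real) set \<Rightarrow> ('s \<Rightarrow>\<^sub>0 real) set \<Rightarrow> 's word set \<Rightarrow> bool" where
  "minimal X Y u \<longleftrightarrow> u \<in> W_sub X \<and>
    (\<forall>v \<in> u <#\<^bsub>W\<^esub> W_sub Y. word_length_in W (R X) u \<le> word_length_in W (R X) v)"


section \<open>Coxeter polytopes and the two complexes\<close>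

definition dual_vector :: "('s \<Rightarrow>\<^sub>0 real) set \<Rightarrow> ('s \<Rightarrow>\<^sub>0 real) \<Rightarrow> ('s \<Rightarrow>\<^sub>0 real)" where
  "dual_vector X \<beta> =
    (THE v. v \<in> span X \<and> (\<forall>\<gamma>\<in>X. form v \<gamma> = (if \<gamma> = \<beta> then 1 else 0)))"

definition base_point :: "('s \<Rightarrow>\<^sub>0 real) set \<Rightarrow> ('s \<Rightarrow>\<^sub>0 real)" where
  "base_point X = (\<Sum>\<beta>\<in>X. dual_vector X \<beta>)"

definition polytope :: "('s \<Rightarrow>\<^sub>0 real) set \<Rightarrow> ('s \<Rightarrow>\<^sub>0 real) set" where
  "polytope X = convex hull {act z (base_point X) | z. z \<in> W_sub X}"

definition face :: "'s word set \<Rightarrow> ('s \<Rightarrow>\<^sub>0 real) set \<Rightarrow> ('s \<Rightarrow>\<^sub>0 real) set \<Rightarrow> ('s \<Rightarrow>\<^sub>0 real) set" where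
  "face u Y X = convex hull {act (u \<otimes>\<^bsub>W\<^esub> z) (base_point X) | z. z \<in> W_sub Y}"

definition Sigma_gluing ::
  "((('s word set \<times> ('s \<Rightarrow>\<^sub>0 real) set) \<times> ('s \<Rightarrow>\<^sub>0 real)) \<times>
    (('s word set \<times> ('s \<Rightarrow>\<^sub>0 real) set) \<times> ('s \<Rightarrow>\<^sub>0 real))) set" where
  "Sigma_gluing =
    {(((z, X), x), ((z \<otimes>\<^bsub>W\<^esub> u, Y), act (inv\<^bsub>W\<^esub> u) x + base_point Y - base_point X)) | z X u Y x.
      z \<in> carrier W \<and> X \<in> Rf \<and> Y \<subset> X \<and> minimal X Y u \<and> x \<in> face u Y X}"

definition Omega_gluing ::
  "((('s word set \<times> ('s \<Rightarrow>\<^sub>0 real) set) \<times> ('s \<Rightarrow>\<^sub>0 real)) \<times>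
    (('s word set \<times> ('s \<Rightarrow>\<^sub>0 real) set) \<times> ('s \<Rightarrow>\<^sub>0 real))) set" where
  "Omega_gluing =
    {(((z, X), x), ((z \<otimes>\<^bsub>W\<^esub> inv\<^bsub>W\<^esub> u, act u ` Y), x + act u (base_point Y - base_point X))) | z X u Y x.
      z \<in> carrier W \<and> X \<in> Rf \<and> Y \<subset> X \<and> minimal X Y u \<and> x \<in> face u Y X}"

definition Sigma_bar where
  "Sigma_bar = glued_complex (carrier W \<times> Rf) (\<lambda>(z, X). card X) (\<lambda>(z, X). polytope X) Sigma_gluing"

definition Omega_bar where
  "Omega_bar = glued_complex (carrier W \<times> Rf) (\<lambda>(z, X). card X) (\<lambda>(z, X). polytope X) Omega_gluing"

end

end

theory Submission
  imports Defs
begin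

text \<open>
  Sending the point \<open>x\<close> of the cell \<open>(z, X)\<close> of \<open>\<Sigma>\<close> to the point \<open>z x\<close> of the cell \<open>(z\<inverse>, z X)\<close> of \<open>\<Omega>\<close>
  defines an involution on the disjoint union of all models. Since \<open>z C[X] = C[z X]\<close> and
  \<open>z F(u, Y, X) = F(z u z\<inverse>, z Y, z X)\<close>, it exchanges the two gluing prescriptions. The only point
  that is not formal is the equivariance of the base points, which needs dual bases to exist: for
  finite \<open>W\<^sub>X\<close>, averaging over \<open>W\<^sub>X\<close> shows that the form is nondegenerate on \<open>span X\<close>.
\<close>

section \<open>Isomorphisms of glued complexes\<close>

text \<open>The attaching maps of \<open>Sigma_bar\<close> work in coordinates local to a cell: a
  face is rotated back by the inverse of \<open>u\<close>, and the label \<open>z u\<close>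
  remembers the rotation. Those of \<open>Omega_bar\<close> work in a frame shared by a cell and its
  faces: faces are only translated, and the rotation is absorbed into the root set
  \<open>u Y\<close>. Applying \<open>z\<close> passes from the local frame to the shared one, which
  is why roots are moved and the label is inverted. Both spaces are quotients by generated
  relations, so it suffices to match generating pairs in both directions. Two definitions determine
  what else has to be proved. \<open>act\<close> evaluates an arbitrary word of a class, so every
  relator must be shown to act trivially; the dihedral relators are the substantial case.
  \<open>dual_vector\<close> is a definite description, so it can be computed with only once exactly
  one vector is known to qualify.\<close>

lemma glue_rel_Sigma:
  assumes "(p, q) \<in> glue_rel I D G" "p \<in> Sigma I D"
  shows "q \<in> Sigma I D"
  using assms unfolding glue_rel_def by (induction rule: rtrancl_induct) auto

text \<open>The generators are cut down to the disjoint union before the closure is taken, so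
  \<open>F\<close> has to respect only those pairs with both ends in it.\<close>

lemma glue_rel_map:
  assumes "(p, q) \<in> glue_rel I D G"
    and F: "\<And>p. p \<in> Sigma I D \<Longrightarrow> F p \<in> Sigma J E"
    and G: "\<And>p q. (p, q) \<in> G \<Longrightarrow> p \<in> Sigma I D \<Longrightarrow> q \<in> Sigma I D \<Longrightarrow> (F p, F q) \<in> H"
  shows "(F p, F q) \<in> glue_rel J E H"
  using assms(1) unfolding glue_rel_def
proof (induction rule: rtrancl_induct)
  case (step y z)
  then have "(F y, F z) \<in> (H \<union> H\<inverse>) \<inter> Sigma J E \<times> Sigma J E"
    using F G by blast
  with step.IH show ?case by (rule rtrancl_into_rtrancl)
qed simp

lemma openin_glue: "openin (topology (glue_open I D G)) U \<longleftrightarrow> glue_open I D G U"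
  using istopology_glue_open[of I D G] topology_inverse'[of "glue_open I D G"] by simp

lemma topspace_glue: "topspace (topology (glue_open I D G)) = Sigma I D // glue_rel I D G"
proof -
  have "glue_open I D G (Sigma I D // glue_rel I D G)"
    unfolding glue_open_def
  proof (intro conjI ballI)
    fix i assume "i \<in> I"
    then have "{x \<in> D i. glue_rel I D G `` {(i, x)} \<in> Sigma I D // glue_rel I D G} = D i"
      by (auto intro!: quotientI)
    then show "openin (top_of_set (D i))
        {x \<in> D i. glue_rel I D G `` {(i, x)} \<in> Sigma I D // glue_rel I D G}"
      by simp
  qed simp
  then show ?thesis
    unfolding topspace_def openin_glue by (auto simp: glue_open_def)
qed

text \<open>Openness in a glued complex is tested on each model separately, and on
  \<open>D i\<close> the preimage of \<open>U\<close> under \<open>f\<close> is the preimage under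
  \<open>h i\<close> of the trace of \<open>U\<close> on the single model
  \<open>E (\<sigma> i)\<close>.\<close>

lemma continuous_map_glue:
  assumes \<sigma>: "\<And>i. i \<in> I \<Longrightarrow> \<sigma> i \<in> J"
    and cont: "\<And>i. i \<in> I \<Longrightarrow> continuous_on (D i) (h i)"
    and img: "\<And>i x. i \<in> I \<Longrightarrow> x \<in> D i \<Longrightarrow> h i x \<in> E (\<sigma> i)"
    and f: "\<And>i x. i \<in> I \<Longrightarrow> x \<in> D i \<Longrightarrow>
      f (glue_rel I D G `` {(i, x)}) = glue_rel J E H `` {(\<sigma> i, h i x)}"
  shows "continuous_map (topology (glue_open I D G)) (topology (glue_open J E H)) f"
  unfolding continuous_map_def topspace_glue openin_glue
proof (intro conjI allI impI)
  show fQ: "f \<in> Sigma I D // glue_rel I D G \<rightarrow> Sigma J E // glue_rel J E H"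
    using \<sigma> img by (auto elim!: quotientE simp: f intro!: quotientI)
  fix U assume U: "glue_open J E H U"
  show "glue_open I D G {A \<in> Sigma I D // glue_rel I D G. f A \<in> U}"
    unfolding glue_open_def
  proof (intro conjI ballI)
    fix i assume i: "i \<in> I"
    let ?V = "{y \<in> E (\<sigma> i). glue_rel J E H `` {(\<sigma> i, y)} \<in> U}"
    have "{x \<in> D i. glue_rel I D G `` {(i, x)} \<in> {A \<in> Sigma I D // glue_rel I D G. f A \<in> U}}
        = D i \<inter> h i -` ?V"
      using i img by (auto simp: f intro!: quotientI)
    moreover have "openin (top_of_set (E (\<sigma> i))) ?V"
      using U \<sigma>[OF i] by (simp add: glue_open_def)
    then have "openin (top_of_set (D i)) (D i \<inter> h i -` ?V)"
      using i cont img by (intro continuous_openin_preimage) auto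
    ultimately show "openin (top_of_set (D i))
        {x \<in> D i. glue_rel I D G `` {(i, x)} \<in> {A \<in> Sigma I D // glue_rel I D G. f A \<in> U}}"
      by simp
  qed auto
qed

lemma cellular_isomorphism_glued_complex:
  fixes D :: "'i \<Rightarrow> 'v::real_normed_vector set" and E :: "'j \<Rightarrow> 'w::real_normed_vector set"
  assumes \<sigma>: "\<And>i. i \<in> I \<Longrightarrow> \<sigma> i \<in> J" "\<And>i. i \<in> I \<Longrightarrow> \<tau> (\<sigma> i) = i"
    and \<tau>: "\<And>j. j \<in> J \<Longrightarrow> \<tau> j \<in> I" "\<And>j. j \<in> J \<Longrightarrow> \<sigma> (\<tau> j) = j"
    and h: "\<And>i. i \<in> I \<Longrightarrow> continuous_on (D i) (h i)" "\<And>i. i \<in> I \<Longrightarrow> h i ` D i = E (\<sigma> i)"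
      "\<And>i x. i \<in> I \<Longrightarrow> x \<in> D i \<Longrightarrow> k (\<sigma> i) (h i x) = x"
    and k: "\<And>j. j \<in> J \<Longrightarrow> continuous_on (E j) (k j)"
    and int: "\<And>i. i \<in> I \<Longrightarrow> h i ` rel_interior (D i) = rel_interior (E (\<sigma> i))"
    and dim: "\<And>i. i \<in> I \<Longrightarrow> e (\<sigma> i) = d i"
    and G: "\<And>i x j y. ((i, x), (j, y)) \<in> G \<Longrightarrow> i \<in> I \<Longrightarrow> x \<in> D i \<Longrightarrow> j \<in> I \<Longrightarrow> y \<in> D j \<Longrightarrow>
      ((\<sigma> i, h i x), (\<sigma> j, h j y)) \<in> H"
    and H: "\<And>i x j y. ((i, x), (j, y)) \<in> H \<Longrightarrow> i \<in> J \<Longrightarrow> x \<in> E i \<Longrightarrow> j \<in> J \<Longrightarrow> y \<in> E j \<Longrightarrow>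
      ((\<tau> i, k i x), (\<tau> j, k j y)) \<in> G"
  shows "\<exists>f. cellular_isomorphism (glued_complex I d D G) (glued_complex J e E H) f"
proof -
  define F where "F = (\<lambda>(i, x). (\<sigma> i, h i x))"
  define F' where "F' = (\<lambda>(j, y). (\<tau> j, k j y))"
  \<comment> \<open>Only \<open>k\<close> after \<open>h\<close> is assumed to be the identity;
    surjectivity of \<open>h\<close> onto the models yields the other composition.\<close>
  have kE: "k j y \<in> D (\<tau> j)" and hk: "h (\<tau> j) (k j y) = y" if "j \<in> J" "y \<in> E j" for j y
  proof -
    have "y \<in> h (\<tau> j) ` D (\<tau> j)"
      unfolding h(2)[OF \<tau>(1)[OF that(1)]] \<tau>(2)[OF that(1)] by (rule that(2))
    then obtain x where x: "x \<in> D (\<tau> j)" "y = h (\<tau> j) x"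
      by (rule imageE)
    have "k j y = x"
      using h(3)[OF \<tau>(1)[OF that(1)] x(1)] unfolding \<tau>(2)[OF that(1)] x(2) .
    with x show "k j y \<in> D (\<tau> j)" "h (\<tau> j) (k j y) = y"
      by simp_all
  qed
  have hE: "h i x \<in> E (\<sigma> i)" if "i \<in> I" "x \<in> D i" for i x
    using h(2)[OF that(1)] that(2) by blast
  have F: "F p \<in> Sigma J E" "F' (F p) = p" if "p \<in> Sigma I D" for p
    using that \<sigma> hE h(3) by (auto simp: F_def F'_def)
  have F': "F' q \<in> Sigma I D" "F (F' q) = q" if "q \<in> Sigma J E" for q
    using that \<tau> kE hk by (auto simp: F_def F'_def)
  have FR: "(F p, F q) \<in> glue_rel J E H" if "(p, q) \<in> glue_rel I D G" for p q
    by (rule glue_rel_map[OF that]) (auto simp: F, auto simp: F_def intro: G)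
  have FR': "(F' p, F' q) \<in> glue_rel I D G" if "(p, q) \<in> glue_rel J E H" for p q
    by (rule glue_rel_map[OF that]) (auto simp: F', auto simp: F'_def intro: H)
  \<comment> \<open>Respecting the relation gives only that the image of a class lies inside a
    class. Since the inverse \<open>F'\<close> respects it too, the image is a whole class, so
    taking images under \<open>F\<close> is a map between the quotients.\<close>
  have imF: "F ` (glue_rel I D G `` {p}) = glue_rel J E H `` {F p}" if p: "p \<in> Sigma I D" for p
  proof (intro subset_antisym subsetI)
    fix q assume q: "q \<in> glue_rel J E H `` {F p}"
    then have "q \<in> Sigma J E"
      using glue_rel_Sigma F(1)[OF p] by fastforce
    moreover have "(F' (F p), F' q) \<in> glue_rel I D G"
      using q by (auto intro: FR')
    ultimately show "q \<in> F ` (glue_rel I D G `` {p})"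
      using F(2)[OF p] F'(2) by (metis Image_singleton_iff imageI)
  qed (auto intro: FR)
  have imF': "F' ` (glue_rel J E H `` {q}) = glue_rel I D G `` {F' q}" if q: "q \<in> Sigma J E" for q
  proof (intro subset_antisym subsetI)
    fix p assume p: "p \<in> glue_rel I D G `` {F' q}"
    then have "p \<in> Sigma I D"
      using glue_rel_Sigma F'(1)[OF q] by fastforce
    moreover have "(F (F' q), F p) \<in> glue_rel J E H"
      using p by (auto intro: FR)
    ultimately show "p \<in> F' ` (glue_rel J E H `` {q})"
      using F'(2)[OF q] F(2) by (metis Image_singleton_iff imageI)
  qed (auto intro: FR')
  let ?K = "glued_complex I d D G" and ?L = "glued_complex J e E H"
  have char: "F ` char_map ?K i x = char_map ?L (\<sigma> i) (h i x)" if "i \<in> I" "x \<in> D i" for i x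
    using imF[of "(i, x)"] that by (simp add: glued_complex_def F_def)
  have char_im: "(`) F ` char_map ?K i ` A = char_map ?L (\<sigma> i) ` h i ` A" if "i \<in> I" "A \<subseteq> D i" for i A
    unfolding image_image using that by (intro image_cong HOL.refl char) auto
  have "homeomorphic_maps (total_space ?K) (total_space ?L) ((`) F) ((`) F')"
    unfolding homeomorphic_maps_def glued_complex_def cell_complex.simps topspace_glue
  proof (intro conjI ballI)
    show "continuous_map (topology (glue_open I D G)) (topology (glue_open J E H)) ((`) F)"
      using \<sigma>(1) h(1) hE imF by (intro continuous_map_glue[where \<sigma> = \<sigma> and h = h]) (auto simp: F_def)
    show "continuous_map (topology (glue_open J E H)) (topology (glue_open I D G)) ((`) F')"
      using \<tau>(1) k kE imF' by (intro continuous_map_glue[where \<sigma> = \<tau> and h = k]) (auto simp: F'_def)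
    show "F' ` F ` A = A" if "A \<in> Sigma I D // glue_rel I D G" for A
      by (rule quotientE[OF that]) (simp only: imF imF' F)
    show "F ` F' ` A = A" if "A \<in> Sigma J E // glue_rel J E H" for A
      by (rule quotientE[OF that]) (simp only: imF imF' F')
  qed
  then have "homeomorphic_map (total_space ?K) (total_space ?L) ((`) F)"
    by (simp add: homeomorphic_maps_map)
  moreover have "(`) F ` skeleton ?K n = skeleton ?L n" for n
  proof -
    have cell: "char_map ?L (\<sigma> i) ` E (\<sigma> i) = (`) F ` char_map ?K i ` D i" if "i \<in> I" for i
      unfolding h(2)[OF that, symmetric] by (rule char_im[OF that order_refl, symmetric])
    have "{j \<in> J. e j \<le> n} = \<sigma> ` {i \<in> I. d i \<le> n}"
      using \<sigma> \<tau> dim by (auto simp: image_iff) metis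
    then have "skeleton ?L n = (\<Union>i\<in>{i \<in> I. d i \<le> n}. char_map ?L (\<sigma> i) ` E (\<sigma> i))"
      by (simp add: skeleton_def glued_complex_def)
    also have "\<dots> = (\<Union>i\<in>{i \<in> I. d i \<le> n}. (`) F ` char_map ?K i ` D i)"
      by (rule SUP_cong[OF HOL.refl cell]) simp
    also have "\<dots> = (`) F ` skeleton ?K n"
      by (simp add: skeleton_def image_UN glued_complex_def)
    finally show ?thesis by simp
  qed
  moreover have "bij_betw \<sigma> I J"
    using \<sigma> \<tau> by (intro bij_betw_byWitness[where f' = \<tau>]) auto
  moreover have "(`) F ` open_cell ?K i = open_cell ?L (\<sigma> i)" if "i \<in> I" for i
  proof -
    have "(`) F ` char_map ?K i ` rel_interior (D i) = char_map ?L (\<sigma> i) ` h i ` rel_interior (D i)"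
      using that rel_interior_subset by (intro char_im) auto
    then show ?thesis
      using int[OF that] by (simp add: open_cell_def glued_complex_def)
  qed
  ultimately have "cellular_isomorphism ?K ?L ((`) F)"
    unfolding cellular_isomorphism_def using dim
    by (auto simp: glued_complex_def intro!: exI[of _ \<sigma>])
  then show ?thesis
    by blast
qed

text \<open>Linear maps commute with affine hulls, and open sets are transported by pulling them
  back along the inverse. The ambient space may be infinite-dimensional, hence boundedness is
  required of the inverse as well.\<close>

lemma rel_interior_bounded_linear_bij:
  assumes f: "bounded_linear f" and g: "bounded_linear g"
    and gf: "\<And>x. g (f x) = x" and fg: "\<And>y. f (g y) = y"
  shows "rel_interior (f ` A) = f ` rel_interior A"
proof -
  \<comment> \<open>Stated for an arbitrary pair of mutually inverse maps, so that it also applies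
    to \<open>g\<close> and gives the reverse inclusion.\<close>
  have *: "f ` rel_interior A \<subseteq> rel_interior (f ` A)"
    if f: "bounded_linear f" and g: "bounded_linear g"
    and gf: "\<And>x. g (f x) = x" and fg: "\<And>y. f (g y) = y" for f :: "'c::real_normed_vector \<Rightarrow> 'd::real_normed_vector" and g A
  proof
    fix y assume "y \<in> f ` rel_interior A"
    then obtain x T where x: "y = f x" "x \<in> A" "open T" "x \<in> T" "T \<inter> affine hull A \<subseteq> A"
      by (auto simp: rel_interior)
    have "open (g -` T)"
      using \<open>open T\<close> linear_continuous_on[OF g, of UNIV] continuous_on_open_vimage[of UNIV g] by auto
    moreover have "g -` T \<inter> affine hull (f ` A) \<subseteq> f ` A"
      unfolding affine_hull_linear_image[OF f, symmetric] using x(5) gf by auto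
    ultimately show "y \<in> rel_interior (f ` A)"
      unfolding rel_interior using x gf by auto
  qed
  show ?thesis
  proof
    have "g ` rel_interior (f ` A) \<subseteq> rel_interior (g ` f ` A)"
      by (rule *[OF g f fg gf])
    then have "f ` g ` rel_interior (f ` A) \<subseteq> f ` rel_interior (g ` f ` A)"
      by blast
    then show "rel_interior (f ` A) \<subseteq> f ` rel_interior A"
      by (simp add: image_image gf fg)
  qed (rule *[OF assms])
qed

section \<open>Group presentations\<close>

lemma words_Nil [simp]: "[] \<in> words X"
  by (simp add: words_def)

lemma words_Cons [simp]: "a # w \<in> words X \<longleftrightarrow> fst a \<in> X \<and> w \<in> words X"
  by (cases a) (auto simp: words_def)

lemma words_append [simp]: "v @ w \<in> words X \<longleftrightarrow> v \<in> words X \<and> w \<in> words X"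
  by (auto simp: words_def)

lemma pres_rel_words: "(v, w) \<in> pres_rel X R \<Longrightarrow> v \<in> words X \<and> w \<in> words X"
  by (induction rule: pres_rel.induct) auto

lemma equiv_pres_rel: "equiv (words X) (pres_rel X R)"
  by (rule equivI)
     (auto simp: refl_on_def sym_def trans_def dest: pres_rel_words
       intro: pres_rel.refl pres_rel.sym pres_rel.trans)

lemma pres_rel_append:
  assumes "(v, v') \<in> pres_rel X R" "(w, w') \<in> pres_rel X R"
  shows "(v @ w, v' @ w') \<in> pres_rel X R"
proof (rule pres_rel.trans)
  show "(v @ w, v' @ w) \<in> pres_rel X R"
    using pres_rel.congr[OF assms(1), of "[]" w] pres_rel_words[OF assms(2)] by simp
  show "(v' @ w, v' @ w') \<in> pres_rel X R"
    using pres_rel.congr[OF assms(2), of v' "[]"] pres_rel_words[OF assms(1)] by simp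
qed

lemma carrier_presented_group:
  "carrier (presented_group X R) = (\<lambda>w. pres_rel X R `` {w}) ` words X"
  by (auto simp: presented_group_def quotient_def)

lemma mult_presented_group:
  assumes "v \<in> words X" "w \<in> words X"
  shows "pres_rel X R `` {v} \<otimes>\<^bsub>presented_group X R\<^esub> pres_rel X R `` {w} = pres_rel X R `` {v @ w}"
proof -
  have "congruent2 (pres_rel X R) (pres_rel X R) (\<lambda>a b. pres_rel X R `` {a @ b})"
    by (rule congruent2I')
       (auto intro!: equiv_class_eq[OF equiv_pres_rel] pres_rel_append)
  from UN_equiv_class2[OF equiv_pres_rel equiv_pres_rel this assms] show ?thesis
    by (simp add: presented_group_def)
qed

lemma one_presented_group: "\<one>\<^bsub>presented_group X R\<^esub> = pres_rel X R `` {[]}"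
  by (simp add: presented_group_def)

definition formal_inverse :: "'a word \<Rightarrow> 'a word" where
  "formal_inverse w = rev (map (\<lambda>(x, e). (x, \<not> e)) w)"

lemma formal_inverse_words: "w \<in> words X \<Longrightarrow> formal_inverse w \<in> words X"
  by (auto simp: formal_inverse_def words_def)

lemma formal_inverse_cancel:
  "w \<in> words X \<Longrightarrow> (formal_inverse w @ w, []) \<in> pres_rel X R"
proof (induction w)
  case (Cons a w)
  obtain x e where a: "a = (x, e)" by (cases a)
  have x: "x \<in> X" and w: "w \<in> words X" using Cons.prems a by auto
  have "(formal_inverse w @ [(x, \<not> e), (x, e)] @ w, formal_inverse w @ [] @ w) \<in> pres_rel X R"
    using pres_rel.cancel[OF x, of "\<not> e"] w by (intro pres_rel.congr formal_inverse_words) auto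
  with Cons.IH[OF w] show ?case
    by (auto simp: a formal_inverse_def intro: pres_rel.trans)
qed (auto simp: formal_inverse_def intro: pres_rel.refl)

lemma group_presented_group: "group (presented_group X R)"
proof (rule groupI)
  fix x assume "x \<in> carrier (presented_group X R)"
  then obtain w where w: "w \<in> words X" "x = pres_rel X R `` {w}"
    by (auto simp: carrier_presented_group)
  have "pres_rel X R `` {formal_inverse w} \<otimes>\<^bsub>presented_group X R\<^esub> x = \<one>\<^bsub>presented_group X R\<^esub>"
    unfolding w(2) using w(1)
    by (auto simp: mult_presented_group formal_inverse_words one_presented_group
        intro!: equiv_class_eq[OF equiv_pres_rel] formal_inverse_cancel)
  then show "\<exists>y\<in>carrier (presented_group X R).
      y \<otimes>\<^bsub>presented_group X R\<^esub> x = \<one>\<^bsub>presented_group X R\<^esub>"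
    using formal_inverse_words[OF w(1)] by (auto simp: carrier_presented_group)
qed (auto simp: carrier_presented_group mult_presented_group one_presented_group)

section \<open>Auxiliary facts on finitely supported functions, iterates and word lengths\<close>

lemma keys_scaleR: "Poly_Mapping.keys (r *\<^sub>R x) \<subseteq> Poly_Mapping.keys x"
  and lookup_scaleR: "Poly_Mapping.lookup (r *\<^sub>R x) i = r *\<^sub>R Poly_Mapping.lookup x i"
  for x :: "'a \<Rightarrow>\<^sub>0 'b::real_vector"
proof -
  have "{i. r *\<^sub>R Poly_Mapping.lookup x i \<noteq> 0} \<subseteq> Poly_Mapping.keys x"
    by (auto simp: in_keys_iff)
  then have "finite {i. r *\<^sub>R Poly_Mapping.lookup x i \<noteq> 0}"
    by (rule finite_subset) simp
  then show "Poly_Mapping.lookup (r *\<^sub>R x) i = r *\<^sub>R Poly_Mapping.lookup x i" for i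
    by (simp add: scaleR_poly_mapping_def)
  then show "Poly_Mapping.keys (r *\<^sub>R x) \<subseteq> Poly_Mapping.keys x"
    by (auto simp: in_keys_iff)
qed

lemma norm_poly_mapping_sum:
  "norm v = (\<Sum>t\<in>Poly_Mapping.keys v. norm (Poly_Mapping.lookup v t))"
  for v :: "'a \<Rightarrow>\<^sub>0 'b::real_normed_vector"
  by (simp add: norm_poly_mapping_def dist_poly_mapping_def)

lemma bounded_linear_funpow:
  fixes f :: "'a::real_normed_vector \<Rightarrow> 'a"
  assumes "bounded_linear f" shows "bounded_linear (f ^^ n)"
proof (induction n)
  case 0
  show ?case using bounded_linear_ident by (simp add: id_def)
next
  case (Suc n)
  then show ?case using bounded_linear_compose[OF assms] by (simp add: comp_def)
qed

text \<open>Words over \<open>A\<close> and over \<open>h\<close> followed by \<open>A\<close>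
  correspond letter by letter, and injectivity of \<open>h\<close> lifts the equation between
  products. The predicates under \<open>LEAST\<close> agree for each \<open>n\<close>, so the
  equality also covers elements that no word represents.\<close>

lemma word_length_in_image:
  assumes G: "group G" and H: "group H" and h: "h \<in> hom G H" "inj_on h (carrier G)"
    and A: "A \<subseteq> carrier G" and g: "g \<in> carrier G"
  shows "word_length_in H (h ` A) (h g) = word_length_in G A g"
proof -
  interpret group_hom G H h
    by (intro group_hom.intro group_hom_axioms.intro G H h(1))
  have foldr_closed: "foldr (\<otimes>\<^bsub>G\<^esub>) rs \<one>\<^bsub>G\<^esub> \<in> carrier G" if "set rs \<subseteq> A" for rs
    using that A by (induction rs) auto
  have foldr_map: "foldr (\<otimes>\<^bsub>H\<^esub>) (map h rs) \<one>\<^bsub>H\<^esub> = h (foldr (\<otimes>\<^bsub>G\<^esub>) rs \<one>\<^bsub>G\<^esub>)" if "set rs \<subseteq> A" for rs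
    using that A by (induction rs) (auto simp: foldr_closed)
  have "(\<exists>rs. set rs \<subseteq> h ` A \<and> length rs = n \<and> foldr (\<otimes>\<^bsub>H\<^esub>) rs \<one>\<^bsub>H\<^esub> = h g) \<longleftrightarrow>
      (\<exists>rs. set rs \<subseteq> A \<and> length rs = n \<and> foldr (\<otimes>\<^bsub>G\<^esub>) rs \<one>\<^bsub>G\<^esub> = g)" (is "?L \<longleftrightarrow> ?R") for n
  proof
    assume ?L
    then obtain rs where rs: "set rs \<subseteq> h ` A" "length rs = n" "foldr (\<otimes>\<^bsub>H\<^esub>) rs \<one>\<^bsub>H\<^esub> = h g"
      by blast
    let ?rs = "map (inv_into A h) rs"
    have "map h ?rs = rs"
      using rs(1) by (auto simp: f_inv_into_f intro!: map_idI)
    moreover have "set ?rs \<subseteq> A"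
      using rs(1) by (auto intro: inv_into_into)
    ultimately have "foldr (\<otimes>\<^bsub>G\<^esub>) ?rs \<one>\<^bsub>G\<^esub> = g"
      using foldr_map[of ?rs] foldr_closed[of ?rs] rs(3) h(2) g by (auto dest: inj_onD)
    with \<open>set ?rs \<subseteq> A\<close> rs(2) show ?R
      by (intro exI[of _ ?rs]) simp
  next
    assume ?R
    then obtain rs where "set rs \<subseteq> A" "length rs = n" "foldr (\<otimes>\<^bsub>G\<^esub>) rs \<one>\<^bsub>G\<^esub> = g"
      by blast
    then show ?L
      using foldr_map[of rs] by (intro exI[of _ "map h rs"]) auto
  qed
  then show ?thesis
    by (simp add: word_length_in_def)
qed

section \<open>Conjugation as an injective endomorphism\<close>

context group
begin

definition conjugate :: "'a \<Rightarrow> 'a \<Rightarrow> 'a" where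
  "conjugate z u = z \<otimes> u \<otimes> inv z"

lemma conjugate_closed [simp]: "z \<in> carrier G \<Longrightarrow> u \<in> carrier G \<Longrightarrow> conjugate z u \<in> carrier G"
  by (simp add: conjugate_def)

lemma conjugate_mult:
  "z \<in> carrier G \<Longrightarrow> u \<in> carrier G \<Longrightarrow> v \<in> carrier G \<Longrightarrow> conjugate z (u \<otimes> v) = conjugate z u \<otimes> conjugate z v"
  by (simp add: conjugate_def m_assoc inv_solve_left)

lemma conjugate_hom: "z \<in> carrier G \<Longrightarrow> conjugate z \<in> hom G G"
  by (auto simp: hom_def conjugate_mult)

lemma conjugate_inj: "z \<in> carrier G \<Longrightarrow> inj_on (conjugate z) (carrier G)"
  by (auto simp: inj_on_def conjugate_def)

lemma generate_conjugate:
  assumes "z \<in> carrier G" "A \<subseteq> carrier G"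
  shows "generate G (conjugate z ` A) = conjugate z ` generate G A"
  using group_hom.generate_img[of G G "conjugate z" A] assms
  by (simp add: group_hom_def group_hom_axioms_def conjugate_hom is_group)

end

context coxeter_graph
begin

section \<open>The action on the root space\<close>

text \<open>Keys can cancel in a sum of vectors, so bilinearity is checked over a common finite
  index set, on which the additional terms vanish.\<close>

lemma form_eq_sum:
  assumes "finite A" "finite B" "Poly_Mapping.keys v \<subseteq> A" "Poly_Mapping.keys w \<subseteq> B"
  shows "form v w = (\<Sum>s\<in>A. \<Sum>t\<in>B. Poly_Mapping.lookup v s * Poly_Mapping.lookup w t * form_coeff s t)"
proof -
  have "form v w = (\<Sum>s\<in>Poly_Mapping.keys v. \<Sum>t\<in>B.
      Poly_Mapping.lookup v s * Poly_Mapping.lookup w t * form_coeff s t)"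
    unfolding form_def using assms
    by (intro sum.cong HOL.refl sum.mono_neutral_left) (auto simp: in_keys_iff)
  also have "\<dots> = (\<Sum>s\<in>A. \<Sum>t\<in>B. Poly_Mapping.lookup v s * Poly_Mapping.lookup w t * form_coeff s t)"
    using assms by (intro sum.mono_neutral_left) (auto simp: in_keys_iff)
  finally show ?thesis .
qed

lemma linear_form_right: "linear (form v)"
proof (rule linearI)
  fix w w' :: "'s \<Rightarrow>\<^sub>0 real" and r :: real
  let ?A = "Poly_Mapping.keys v" and ?B = "Poly_Mapping.keys w \<union> Poly_Mapping.keys w'"
  have "form v (w + w') = (\<Sum>s\<in>?A. \<Sum>t\<in>?B.
      Poly_Mapping.lookup v s * Poly_Mapping.lookup (w + w') t * form_coeff s t)"
    by (rule form_eq_sum) (use Poly_Mapping.keys_add[of w w'] in auto)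
  also have "\<dots> = (\<Sum>s\<in>?A. \<Sum>t\<in>?B. Poly_Mapping.lookup v s * Poly_Mapping.lookup w t * form_coeff s t)
      + (\<Sum>s\<in>?A. \<Sum>t\<in>?B. Poly_Mapping.lookup v s * Poly_Mapping.lookup w' t * form_coeff s t)"
    by (simp add: lookup_add algebra_simps sum.distrib)
  also have "\<dots> = form v w + form v w'"
    by (intro arg_cong2[where f = "(+)"] form_eq_sum[symmetric]) auto
  finally show "form v (w + w') = form v w + form v w'" .
  have "form v (r *\<^sub>R w) = (\<Sum>s\<in>?A. \<Sum>t\<in>Poly_Mapping.keys w.
      Poly_Mapping.lookup v s * Poly_Mapping.lookup (r *\<^sub>R w) t * form_coeff s t)"
    by (rule form_eq_sum) (auto intro: keys_scaleR[THEN subsetD])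
  also have "\<dots> = r *\<^sub>R form v w"
    by (simp add: form_def lookup_scaleR sum_distrib_left algebra_simps)
  finally show "form v (r *\<^sub>R w) = r *\<^sub>R form v w" .
qed

text \<open>\<open>m\<close> is known to be symmetric on \<open>S\<close> only. This is the source
  of the side conditions on keys in the later facts about the form.\<close>

lemma form_commute:
  assumes "Poly_Mapping.keys v \<subseteq> S" "Poly_Mapping.keys w \<subseteq> S"
  shows "form v w = form w v"
proof -
  have "form_coeff s t = form_coeff t s" if "s \<in> S" "t \<in> S" for s t
    using m_sym[OF that] by (simp add: form_coeff_def)
  then have "form v w = (\<Sum>s\<in>Poly_Mapping.keys v. \<Sum>t\<in>Poly_Mapping.keys w.
      Poly_Mapping.lookup w t * Poly_Mapping.lookup v s * form_coeff t s)"
    unfolding form_def using assms by (intro sum.cong HOL.refl) (auto simp: subset_iff)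
  also have "\<dots> = form w v"
    unfolding form_def by (rule sum.swap)
  finally show ?thesis .
qed

lemma linear_form_left: "linear (\<lambda>v. form v w)"
proof (rule linearI)
  fix v v' :: "'s \<Rightarrow>\<^sub>0 real" and r :: real
  let ?A = "Poly_Mapping.keys v \<union> Poly_Mapping.keys v'" and ?B = "Poly_Mapping.keys w"
  have "form (v + v') w = (\<Sum>s\<in>?A. \<Sum>t\<in>?B.
      Poly_Mapping.lookup (v + v') s * Poly_Mapping.lookup w t * form_coeff s t)"
    by (rule form_eq_sum) (use Poly_Mapping.keys_add[of v v'] in auto)
  also have "\<dots> = (\<Sum>s\<in>?A. \<Sum>t\<in>?B. Poly_Mapping.lookup v s * Poly_Mapping.lookup w t * form_coeff s t)
      + (\<Sum>s\<in>?A. \<Sum>t\<in>?B. Poly_Mapping.lookup v' s * Poly_Mapping.lookup w t * form_coeff s t)"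
    by (simp add: lookup_add algebra_simps sum.distrib)
  also have "\<dots> = form v w + form v' w"
    by (intro arg_cong2[where f = "(+)"] form_eq_sum[symmetric]) auto
  finally show "form (v + v') w = form v w + form v' w" .
  have "form (r *\<^sub>R v) w = (\<Sum>s\<in>Poly_Mapping.keys v. \<Sum>t\<in>?B.
      Poly_Mapping.lookup (r *\<^sub>R v) s * Poly_Mapping.lookup w t * form_coeff s t)"
    by (rule form_eq_sum) (auto intro: keys_scaleR[THEN subsetD])
  also have "\<dots> = r *\<^sub>R form v w"
    by (simp add: form_def lookup_scaleR sum_distrib_left algebra_simps)
  finally show "form (r *\<^sub>R v) w = r *\<^sub>R form v w" .
qed

lemmas form_simps =
  linear_add[OF linear_form_right] linear_diff[OF linear_form_right] linear_scale[OF linear_form_right]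
  linear_add[OF linear_form_left] linear_diff[OF linear_form_left] linear_scale[OF linear_form_left]

lemma keys_\<alpha> [simp]: "Poly_Mapping.keys (\<alpha> s) = {s}"
  by (simp add: \<alpha>_def)

lemma form_\<alpha>_\<alpha>: "form (\<alpha> s) (\<alpha> t) = form_coeff s t"
  by (simp add: form_def) (simp add: \<alpha>_def)

lemma form_\<alpha>_self: "s \<in> S \<Longrightarrow> form (\<alpha> s) (\<alpha> s) = 1"
  by (simp add: form_\<alpha>_\<alpha> form_coeff_def m_diag one_enat_def)

text \<open>All coefficients of the form have absolute value at most 1 and the norm is the sum of
  the absolute values of the coordinates, hence the bound 1. Continuity of the whole action rests on
  this.\<close>

lemma bounded_linear_form_\<alpha>: "bounded_linear (form (\<alpha> s))"
proof (rule bounded_linear_intro[where K = 1])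
  fix v
  have "\<bar>form (\<alpha> s) v\<bar> \<le> (\<Sum>t\<in>Poly_Mapping.keys v. \<bar>Poly_Mapping.lookup v t * form_coeff s t\<bar>)"
    unfolding form_def by (simp add: \<alpha>_def sum_abs)
  also have "\<dots> \<le> (\<Sum>t\<in>Poly_Mapping.keys v. \<bar>Poly_Mapping.lookup v t\<bar>)"
    by (intro sum_mono) (auto simp: abs_mult form_coeff_def mult_left_le split: enat.split)
  finally show "norm (form (\<alpha> s) v) \<le> norm v * 1"
    by (simp add: norm_poly_mapping_sum)
qed (simp_all add: form_simps)

lemma bounded_linear_simple_reflection: "bounded_linear (simple_reflection s)"
  unfolding simple_reflection_def
  by (intro bounded_linear_sub bounded_linear_ident bounded_linear_scaleR_const
      bounded_linear_const_mult bounded_linear_form_\<alpha>)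

lemma simple_reflection_involution: "s \<in> S \<Longrightarrow> simple_reflection s (simple_reflection s v) = v"
  by (simp add: simple_reflection_def form_simps form_\<alpha>_self algebra_simps)

lemma simple_reflection_keys:
  "s \<in> S \<Longrightarrow> Poly_Mapping.keys v \<subseteq> S \<Longrightarrow> Poly_Mapping.keys (simple_reflection s v) \<subseteq> S"
  using keys_diff[of v "(2 * form (\<alpha> s) v) *\<^sub>R \<alpha> s"] keys_scaleR[of "2 * form (\<alpha> s) v" "\<alpha> s"]
  by (auto simp: simple_reflection_def)

lemma form_simple_reflection:
  assumes "s \<in> S" "Poly_Mapping.keys v \<subseteq> S" "Poly_Mapping.keys w \<subseteq> S"
  shows "form (simple_reflection s v) (simple_reflection s w) = form v w"
  using form_commute[of v "\<alpha> s"] form_\<alpha>_self[of s] assms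
  by (simp add: simple_reflection_def form_simps algebra_simps)

text \<open>The form is nondegenerate on the plane of \<open>\<alpha> s\<close> and
  \<open>\<alpha> t\<close> because \<open>c\<^sup>2 < 1\<close>, so every vector splits into a part
  in the plane and a part orthogonal to it. The product of the two reflections turns the plane by
  \<open>2 * \<theta>\<close>, a full turn after \<open>k\<close> steps, and fixes the orthogonal
  part.\<close>

lemma dihedral_relation:
  assumes s: "s \<in> S" and t: "t \<in> S" and st: "s \<noteq> t" and k: "m s t = enat k"
  shows "((\<lambda>v. simple_reflection s (simple_reflection t v)) ^^ k) v = v"
proof -
  have "k \<ge> 2"
    using m_ge_2[OF s t st] k by (simp add: numeral_eq_enat)
  define \<theta> where "\<theta> = pi / real k"
  have "0 < \<theta>" "\<theta> < pi"
    using \<open>k \<ge> 2\<close> by (auto simp: \<theta>_def field_simps)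
  then have sin: "sin \<theta> > 0"
    by (rule sin_gt_zero)
  define c where "c = cos \<theta>"
  have c: "c\<^sup>2 < 1"
    using zero_less_power[OF sin, of 2] by (simp add: c_def sin_squared_eq)
  have st_form: "form (\<alpha> s) (\<alpha> t) = - c" "form (\<alpha> t) (\<alpha> s) = - c"
    using k m_sym[OF s t] by (simp_all add: form_\<alpha>_\<alpha> form_coeff_def c_def \<theta>_def)
  define f where "f = (\<lambda>v. simple_reflection s (simple_reflection t v))"
  have f: "linear (f ^^ k)"
    unfolding f_def
    by (intro bounded_linear.linear bounded_linear_funpow
        bounded_linear_compose[OF bounded_linear_simple_reflection bounded_linear_simple_reflection])
  \<comment> \<open>\<open>f\<close> rotates the plane of \<open>\<alpha> s\<close> and \<open>\<alpha> t\<close> by \<open>2 \<theta>\<close>, and \<open>E \<phi>\<close> is a vector at angle \<open>\<phi>\<close> from \<open>\<alpha> s\<close>, scaled by \<open>sin \<theta>\<close>.\<close>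
  define E where "E \<phi> = sin (\<phi> + \<theta>) *\<^sub>R \<alpha> s + sin \<phi> *\<^sub>R \<alpha> t" for \<phi>
  have rot: "sin (\<phi> + 2 * \<theta>) = 2 * c * sin (\<phi> + \<theta>) - sin \<phi>" for \<phi>
  proof -
    have "sin ((\<phi> + \<theta>) + \<theta>) + sin ((\<phi> + \<theta>) - \<theta>) = 2 * c * sin (\<phi> + \<theta>)"
      by (simp only: sin_add sin_diff c_def) (simp add: algebra_simps)
    then show ?thesis by (simp add: algebra_simps)
  qed
  have tE: "simple_reflection t (E \<phi>) = sin (\<phi> + \<theta>) *\<^sub>R \<alpha> s + sin (\<phi> + 2 * \<theta>) *\<^sub>R \<alpha> t" for \<phi>
    unfolding rot
    by (simp add: E_def simple_reflection_def form_simps st_form form_\<alpha>_self t algebra_simps)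
      (simp flip: scaleR_left_distrib)
  have stE: "simple_reflection s (sin (\<phi> - \<theta>) *\<^sub>R \<alpha> s + sin \<phi> *\<^sub>R \<alpha> t) = E \<phi>" for \<phi>
  proof -
    have "sin (\<phi> + \<theta>) = 2 * c * sin \<phi> - sin (\<phi> - \<theta>)"
      using rot[of "\<phi> - \<theta>"] by (simp add: add.commute)
    then show ?thesis
      by (simp add: E_def simple_reflection_def form_simps st_form form_\<alpha>_self s
          scaleR_left_diff_distrib scaleR_left_distrib right_diff_distrib distrib_left mult.left_commute mult.commute)
        (simp flip: scaleR_left_diff_distrib scaleR_minus_left)
  qed
  \<comment> \<open>\<open>tE\<close> leaves the coefficients \<open>sin (\<phi> + \<theta>)\<close>
    and \<open>sin (\<phi> + 2 * \<theta>)\<close>, which is the input of \<open>stE\<close> at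
    angle \<open>\<phi> + 2 * \<theta>\<close>.\<close>
  have fE: "f (E \<phi>) = E (\<phi> + 2 * \<theta>)" for \<phi>
    using stE[of "\<phi> + 2 * \<theta>"] by (simp add: f_def tE add.commute)
  have "(f ^^ n) (E \<phi>) = E (\<phi> + real n * (2 * \<theta>))" for n \<phi>
    by (induction n) (simp_all add: fE algebra_simps)
  moreover have "E (\<phi> + real k * (2 * \<theta>)) = E \<phi>" for \<phi>
  proof -
    have "real k * (2 * \<theta>) = 2 * pi"
      using \<open>k \<ge> 2\<close> by (simp add: \<theta>_def)
    moreover have "\<phi> + 2 * pi + \<theta> = (\<phi> + \<theta>) + 2 * pi"
      by simp
    ultimately show ?thesis
      by (simp only: E_def sin_periodic)
  qed
  ultimately have E_fixed: "(f ^^ k) (E \<phi>) = E \<phi>" for \<phi>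
    by simp
  \<comment> \<open>At the angles \<open>0\<close> and \<open>- \<theta>\<close> one of the two
    sines in \<open>E\<close> vanishes; dividing by the other needs \<open>sin \<theta>\<close> to
    be nonzero.\<close>
  have "\<alpha> s = (1 / sin \<theta>) *\<^sub>R E 0" "\<alpha> t = (- 1 / sin \<theta>) *\<^sub>R E (- \<theta>)"
    using sin by (simp_all add: E_def)
  then have \<alpha>_fixed: "(f ^^ k) (\<alpha> s) = \<alpha> s" "(f ^^ k) (\<alpha> t) = \<alpha> t"
    using linear_scale[OF f] E_fixed by (metis (no_types))+
  \<comment> \<open>The coefficients of the projection of \<open>v\<close> to the plane:
    orthogonality of \<open>u\<close> means \<open>x - c * y = form (\<alpha> s) v\<close> and
    \<open>y - c * x = form (\<alpha> t) v\<close>, a system with determinant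
    \<open>1 - c\<^sup>2\<close>.\<close>
  define x where "x = (form (\<alpha> s) v + c * form (\<alpha> t) v) / (1 - c\<^sup>2)"
  define y where "y = (form (\<alpha> t) v + c * form (\<alpha> s) v) / (1 - c\<^sup>2)"
  define u where "u = v - x *\<^sub>R \<alpha> s - y *\<^sub>R \<alpha> t"
  have xy: "x * (1 - c\<^sup>2) = form (\<alpha> s) v + c * form (\<alpha> t) v"
    "y * (1 - c\<^sup>2) = form (\<alpha> t) v + c * form (\<alpha> s) v"
    using c by (simp_all add: x_def y_def)
  have "(x - c * y) * (1 - c\<^sup>2) = x * (1 - c\<^sup>2) - c * (y * (1 - c\<^sup>2))"
    "(y - c * x) * (1 - c\<^sup>2) = y * (1 - c\<^sup>2) - c * (x * (1 - c\<^sup>2))"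
    by (simp_all add: algebra_simps)
  then have "(x - c * y) * (1 - c\<^sup>2) = form (\<alpha> s) v * (1 - c\<^sup>2)"
    "(y - c * x) * (1 - c\<^sup>2) = form (\<alpha> t) v * (1 - c\<^sup>2)"
    unfolding xy by (simp_all add: power2_eq_square algebra_simps)
  then have "x - c * y = form (\<alpha> s) v" "y - c * x = form (\<alpha> t) v"
    using c by simp_all
  then have "form (\<alpha> s) u = 0" "form (\<alpha> t) u = 0"
    by (simp_all add: u_def form_simps st_form form_\<alpha>_self s t algebra_simps)
  then have "f u = u"
    by (simp add: f_def simple_reflection_def)
  then have "(f ^^ n) u = u" for n
    by (induction n) simp_all
  moreover have "v = u + x *\<^sub>R \<alpha> s + y *\<^sub>R \<alpha> t"
    by (simp add: u_def)
  ultimately have "(f ^^ k) v = v"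
    by (simp add: linear_add[OF f] linear_scale[OF f] \<alpha>_fixed)
  then show ?thesis
    by (simp add: f_def)
qed

section \<open>The action of words and of their classes\<close>

definition word_act :: "'s word \<Rightarrow> ('s \<Rightarrow>\<^sub>0 real) \<Rightarrow> ('s \<Rightarrow>\<^sub>0 real)" where
  "word_act w = foldr (\<lambda>(s, e). simple_reflection s) w"

lemma word_act_simps [simp]:
  "word_act [] v = v"
  "word_act ((s, e) # w) v = simple_reflection s (word_act w v)"
  "word_act (w @ w') v = word_act w (word_act w' v)"
  by (simp_all add: word_act_def)

text \<open>This is the well-definedness of \<open>act\<close>. As the sign of a letter is ignored,
  cancellation of formal inverses and the relators of length two both reduce to reflections being
  involutions.\<close>

lemma word_act_cong:
  "(v, w) \<in> pres_rel S coxeter_relators \<Longrightarrow> word_act v x = word_act w x"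
proof (induction arbitrary: x rule: pres_rel.induct)
  case (relator r)
  have "word_act (concat (replicate k [(s, True), (t, True)])) x
      = ((\<lambda>v. simple_reflection s (simple_reflection t v)) ^^ k) x" for k s t
    by (induction k) simp_all
  with relator show ?case
    by (auto simp: coxeter_relators_def simple_reflection_involution dihedral_relation)
qed (simp_all add: simple_reflection_involution)

interpretation W: group W
  unfolding W_def by (rule group_presented_group)

lemma carrier_W: "carrier W = (\<lambda>w. pres_rel S coxeter_relators `` {w}) ` words S"
  by (simp add: W_def carrier_presented_group)

lemma act_class:
  assumes "w \<in> words S"
  shows "act (pres_rel S coxeter_relators `` {w}) v = word_act w v"
proof -
  have "(SOME u. u \<in> pres_rel S coxeter_relators `` {w}) \<in> pres_rel S coxeter_relators `` {w}"
    using pres_rel.refl[OF assms] by (intro someI) auto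
  then show ?thesis
    by (simp add: act_def word_act_def[symmetric] word_act_cong)
qed

lemma act_mult: "x \<in> carrier W \<Longrightarrow> y \<in> carrier W \<Longrightarrow> act (x \<otimes>\<^bsub>W\<^esub> y) v = act x (act y v)"
  by (auto simp: carrier_W act_class) (simp add: W_def mult_presented_group act_class)

lemma act_one [simp]: "act \<one>\<^bsub>W\<^esub> v = v"
  by (simp add: W_def one_presented_group act_class)

lemma act_inv [simp]: "x \<in> carrier W \<Longrightarrow> act (inv\<^bsub>W\<^esub> x) (act x v) = v"
  and act_inv' [simp]: "x \<in> carrier W \<Longrightarrow> act x (act (inv\<^bsub>W\<^esub> x) v) = v"
  by (simp_all flip: act_mult)

lemma act_inv_image [simp]: "x \<in> carrier W \<Longrightarrow> act (inv\<^bsub>W\<^esub> x) ` act x ` A = A"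
  by (simp add: image_image)

lemma inj_act: "x \<in> carrier W \<Longrightarrow> inj (act x)"
  by (metis act_inv injI)

lemma gen_closed [simp]: "s \<in> S \<Longrightarrow> gen s \<in> carrier W"
  by (auto simp: gen_def carrier_W)

lemma act_gen: "s \<in> S \<Longrightarrow> act (gen s) v = simple_reflection s v"
  by (simp add: gen_def act_class)

lemma bounded_linear_act: "x \<in> carrier W \<Longrightarrow> bounded_linear (act x)"
proof -
  assume "x \<in> carrier W"
  then obtain w where w: "w \<in> words S" "x = pres_rel S coxeter_relators `` {w}"
    by (auto simp: carrier_W)
  have "bounded_linear (\<lambda>v. word_act w v)"
  proof (induction w)
    case (Cons a w)
    then show ?case
      using bounded_linear_compose[OF bounded_linear_simple_reflection] by (cases a) simp
  qed (simp add: bounded_linear_ident)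
  moreover have "act x = (\<lambda>v. word_act w v)"
    using w act_class by auto
  ultimately show ?thesis by simp
qed

lemma linear_act: "x \<in> carrier W \<Longrightarrow> linear (act x)"
  by (rule bounded_linear.linear[OF bounded_linear_act])

lemma act_keys:
  assumes "x \<in> carrier W" "Poly_Mapping.keys v \<subseteq> S"
  shows "Poly_Mapping.keys (act x v) \<subseteq> S"
proof -
  have "Poly_Mapping.keys (word_act w v) \<subseteq> S" if "w \<in> words S" for w
    using that
  proof (induction w)
    case (Cons a w)
    then show ?case by (cases a) (simp add: simple_reflection_keys)
  qed (simp add: assms)
  moreover obtain w where "w \<in> words S" "x = pres_rel S coxeter_relators `` {w}"
    using assms(1) by (auto simp: carrier_W)
  ultimately show ?thesis
    by (simp add: act_class)
qed

lemma form_act: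
  assumes "x \<in> carrier W" "Poly_Mapping.keys v \<subseteq> S" "Poly_Mapping.keys w \<subseteq> S"
  shows "form (act x v) (act x w) = form v w"
proof -
  have "form (word_act u v) (word_act u w) = form v w" if "u \<in> words S" for u
    using that
  proof (induction u)
    case (Cons a u)
    then have u: "pres_rel S coxeter_relators `` {u} \<in> carrier W"
      by (auto simp: carrier_W)
    from Cons show ?case
      using act_keys[OF u, of v] act_keys[OF u, of w] assms
      by (cases a) (simp add: form_simple_reflection act_class)
  qed simp
  with assms show ?thesis
    by (auto simp: carrier_W act_class)
qed

lemma keys_root:
  assumes "\<beta> \<in> roots"
  shows "Poly_Mapping.keys \<beta> \<subseteq> S"
proof -
  obtain w s where "w \<in> carrier W" "s \<in> S" "\<beta> = act w (\<alpha> s)"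
    using assms by (auto simp: roots_def)
  then show ?thesis
    using act_keys[of w "\<alpha> s"] by simp
qed

lemma act_root:
  assumes "x \<in> carrier W" "\<beta> \<in> roots"
  shows "act x \<beta> \<in> roots"
proof -
  obtain w s where ws: "w \<in> carrier W" "s \<in> S" "\<beta> = act w (\<alpha> s)"
    using assms(2) by (auto simp: roots_def)
  then have "act x \<beta> = act (x \<otimes>\<^bsub>W\<^esub> w) (\<alpha> s)"
    using assms(1) by (simp add: act_mult)
  with ws assms(1) show ?thesis
    by (auto simp: roots_def)
qed

lemma keys_span:
  assumes "X \<subseteq> roots" "v \<in> span X"
  shows "Poly_Mapping.keys v \<subseteq> S"
proof -
  have "subspace {v :: 's \<Rightarrow>\<^sub>0 real. Poly_Mapping.keys v \<subseteq> S}"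
    by (rule subspaceI) (auto dest!: keys_add[THEN subsetD] keys_scaleR[THEN subsetD])
  then have "span X \<subseteq> {v. Poly_Mapping.keys v \<subseteq> S}"
    using assms(1) keys_root by (intro span_minimal) auto
  with assms(2) show ?thesis by blast
qed

text \<open>Invariance of the form moves \<open>w\<close> from the root to the vector. The result
  involves only the root, so all pairs \<open>(w, s)\<close> presenting the same root give the same
  action on vectors supported in \<open>S\<close>.\<close>

lemma act_reflection:
  assumes w: "w \<in> carrier W" and s: "s \<in> S" and v: "Poly_Mapping.keys v \<subseteq> S"
  shows "act (w \<otimes>\<^bsub>W\<^esub> gen s \<otimes>\<^bsub>W\<^esub> inv\<^bsub>W\<^esub> w) v = v - (2 * form (act w (\<alpha> s)) v) *\<^sub>R act w (\<alpha> s)"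
proof -
  have "form (act w (\<alpha> s)) v = form (\<alpha> s) (act (inv\<^bsub>W\<^esub> w) v)"
    using form_act[OF w, of "\<alpha> s" "act (inv\<^bsub>W\<^esub> w) v"] act_keys[of "inv\<^bsub>W\<^esub> w" v] w s v by simp
  then show ?thesis
    using w s by (simp add: act_mult act_gen simple_reflection_def linear_diff[OF linear_act]
        linear_scale[OF linear_act])
qed

section \<open>Dual bases of spherical sets of roots\<close>

lemma form_root_self:
  assumes "\<beta> \<in> roots"
  shows "form \<beta> \<beta> = 1"
proof -
  obtain w s where "w \<in> carrier W" "s \<in> S" "\<beta> = act w (\<alpha> s)"
    using assms by (auto simp: roots_def)
  then show ?thesis
    by (simp add: form_act form_\<alpha>_self)
qed

lemma R_closed: "R X \<subseteq> carrier W"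
  by (auto simp: R_def)

lemma W_sub_closed: "W_sub X \<subseteq> carrier W"
  unfolding W_sub_def by (rule W.generate_incl[OF R_closed])

lemma R_cases:
  assumes "r \<in> R X"
  obtains \<beta> where "\<beta> \<in> X" "\<And>v. Poly_Mapping.keys v \<subseteq> S \<Longrightarrow> act r v = v - (2 * form \<beta> v) *\<^sub>R \<beta>"
  using assms act_reflection unfolding R_def by blast

lemma root_reflection:
  assumes "X \<subseteq> roots" "\<beta> \<in> X"
  obtains r where "r \<in> R X"
    "\<And>v. Poly_Mapping.keys v \<subseteq> S \<Longrightarrow> act r v = v - (2 * form \<beta> v) *\<^sub>R \<beta>"
proof -
  obtain w s where ws: "w \<in> carrier W" "s \<in> S" "\<beta> = act w (\<alpha> s)"
    using assms by (auto simp: roots_def)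
  show thesis
  proof
    show "w \<otimes>\<^bsub>W\<^esub> gen s \<otimes>\<^bsub>W\<^esub> inv\<^bsub>W\<^esub> w \<in> R X"
      using ws assms(2) by (auto simp: R_def)
  qed (simp add: act_reflection ws)
qed

lemma Rf_roots: "X \<in> Rf \<Longrightarrow> X \<subseteq> roots"
  and Rf_independent: "X \<in> Rf \<Longrightarrow> independent X"
  and Rf_finite_W_sub: "X \<in> Rf \<Longrightarrow> finite (W_sub X)"
  by (simp_all add: Rf_def almost_parabolic_def)

text \<open>Choosing one reflection for each root embeds \<open>X\<close> into the finite group
  \<open>W_sub X\<close>: two roots with the same reflection are proportional, which independence
  excludes.\<close>

lemma Rf_finite:
  assumes X: "X \<in> Rf"
  shows "finite X"
proof -
  have "\<exists>r. r \<in> R X \<and> (\<forall>v. Poly_Mapping.keys v \<subseteq> S \<longrightarrow> act r v = v - (2 * form \<beta> v) *\<^sub>R \<beta>)"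
    if "\<beta> \<in> X" for \<beta>
    using root_reflection[OF Rf_roots[OF X] that] by metis
  then obtain \<rho> where \<rho>: "\<And>\<beta>. \<beta> \<in> X \<Longrightarrow> \<rho> \<beta> \<in> R X"
    "\<And>\<beta> v. \<beta> \<in> X \<Longrightarrow> Poly_Mapping.keys v \<subseteq> S \<Longrightarrow> act (\<rho> \<beta>) v = v - (2 * form \<beta> v) *\<^sub>R \<beta>"
    by metis
  have "inj_on \<rho> X"
  proof (rule inj_onI, rule ccontr)
    fix \<beta> \<gamma> assume bg: "\<beta> \<in> X" "\<gamma> \<in> X" "\<rho> \<beta> = \<rho> \<gamma>" "\<beta> \<noteq> \<gamma>"
    have \<beta>: "\<beta> \<in> roots"
      using Rf_roots[OF X] bg by blast
    \<comment> \<open>The common reflection is evaluated at \<open>\<beta>\<close>, once as the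
      reflection in \<open>\<beta>\<close> and once as the reflection in
      \<open>\<gamma>\<close>.\<close>
    have "- \<beta> = \<beta> - (2 * form \<gamma> \<beta>) *\<^sub>R \<gamma>"
      using \<rho>(2)[OF bg(1) keys_root[OF \<beta>]] \<rho>(2)[OF bg(2) keys_root[OF \<beta>]] bg(3)
      by (simp add: form_root_self[OF \<beta>] scaleR_2)
    then have "2 *\<^sub>R \<beta> = 2 *\<^sub>R (form \<gamma> \<beta> *\<^sub>R \<gamma>)"
      by (simp add: scaleR_2 algebra_simps)
    then have "\<beta> = form \<gamma> \<beta> *\<^sub>R \<gamma>"
      by (rule scaleR_left_imp_eq[rotated]) simp
    then have "\<beta> \<in> span {\<gamma>}"
      by (metis insertI1 span_base span_scale)
    moreover have "independent {\<beta>, \<gamma>}"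
      using Rf_independent[OF X] by (rule independent_mono) (use bg in auto)
    ultimately show False
      using bg(4) by (simp add: independent_insert)
  qed
  moreover have "\<rho> ` X \<subseteq> W_sub X"
    using \<rho>(1) generate.incl by (fastforce simp: W_sub_def)
  ultimately show ?thesis
    using Rf_finite_W_sub[OF X] by (metis finite_imageD finite_subset)
qed

text \<open>
  A vector in the radical of the form on \<open>span X\<close> is fixed by the finite group \<open>W\<^sub>X\<close>, whereas the sum
  over \<open>W\<^sub>X\<close> annihilates every \<open>\<beta> \<in> X\<close>, because \<open>r\<^sub>\<beta>\<close> sends \<open>\<beta>\<close> to \<open>- \<beta>\<close>.
\<close>

lemma Rf_form_nondegenerate:
  assumes X: "X \<in> Rf" and v: "v \<in> span X" and orth: "\<And>\<gamma>. \<gamma> \<in> X \<Longrightarrow> form v \<gamma> = 0"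
  shows "v = 0"
proof -
  note roots = Rf_roots[OF X]
  have keys_v: "Poly_Mapping.keys v \<subseteq> S"
    by (rule keys_span[OF roots v])
  have R_fixed: "act r v = v" if r: "r \<in> R X" for r
  proof -
    obtain \<beta> where \<beta>: "\<beta> \<in> X" "act r v = v - (2 * form \<beta> v) *\<^sub>R \<beta>"
      using R_cases[OF r] keys_v by metis
    moreover have "form \<beta> v = form v \<beta>"
      using form_commute[OF keys_root keys_v] \<beta>(1) roots by blast
    ultimately show ?thesis
      using orth by simp
  qed
  have fixed: "act g v = v" if "g \<in> W_sub X" for g
    using that unfolding W_sub_def
  proof (induction rule: generate.induct)
    case (inv h)
    then show ?case
      using act_inv[of h v] R_closed R_fixed by auto
  next
    case (eng g h)
    then show ?case
      using W.generate_in_carrier[OF R_closed] by (simp add: act_mult)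
  qed (simp_all add: R_fixed)
  define avg where "avg x = (\<Sum>g\<in>W_sub X. act g x)" for x
  have linear_avg: "linear avg"
    unfolding avg_def using W_sub_closed by (intro linear_compose_sum ballI linear_act) auto
  have "avg \<beta> = 0" if \<beta>: "\<beta> \<in> X" for \<beta>
  proof -
    obtain r where r: "r \<in> R X" "\<And>v. Poly_Mapping.keys v \<subseteq> S \<Longrightarrow> act r v = v - (2 * form \<beta> v) *\<^sub>R \<beta>"
      using root_reflection[OF roots \<beta>] by metis
    have "\<beta> \<in> roots"
      using roots \<beta> by blast
    then have "act r \<beta> = - \<beta>"
      using r(2)[OF keys_root] by (simp add: form_root_self scaleR_2)
    have rW: "r \<in> carrier W" "r \<in> W_sub X" "inv\<^bsub>W\<^esub> r \<in> W_sub X"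
      using r(1) R_closed by (auto simp: W_sub_def intro: generate.incl generate.inv)
    \<comment> \<open>Right translation by \<open>r\<close> permutes \<open>W_sub X\<close>, so
      replacing \<open>\<beta>\<close> by its image under \<open>r\<close> does not change the
      sum.\<close>
    have "avg \<beta> = (\<Sum>g\<in>W_sub X. act (g \<otimes>\<^bsub>W\<^esub> r) \<beta>)"
      unfolding avg_def
      by (rule sum.reindex_bij_witness[of _ "\<lambda>g. g \<otimes>\<^bsub>W\<^esub> r" "\<lambda>g. g \<otimes>\<^bsub>W\<^esub> inv\<^bsub>W\<^esub> r"])
        (use rW W_sub_closed in \<open>auto simp: W.m_assoc subset_iff W_sub_def intro: generate.eng\<close>)
    also have "\<dots> = - avg \<beta>"
      unfolding avg_def sum_negf[symmetric] using rW(1) W_sub_closed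
      by (intro sum.cong HOL.refl)
        (auto simp: act_mult \<open>act r \<beta> = - \<beta>\<close> subset_iff linear_neg[OF linear_act])
    finally have "2 *\<^sub>R avg \<beta> = 0"
      by (metis add.right_inverse scaleR_2)
    then show ?thesis by simp
  qed
  then have "avg v = 0"
    using linear_eq_0_on_span[OF linear_avg _ v] by blast
  moreover have "avg v = real (card (W_sub X)) *\<^sub>R v"
    by (simp add: avg_def fixed sum_constant_scaleR)
  moreover have "card (W_sub X) \<noteq> 0"
    using Rf_finite_W_sub[OF X] generate.one[of W "R X"] by (auto simp: W_sub_def)
  ultimately show ?thesis by simp
qed

text \<open>Nondegeneracy gives uniqueness. It also makes \<open>T\<close>, which records the values
  of the form on \<open>X\<close> as coordinates in the basis \<open>X\<close>, injective on
  \<open>span X\<close>, hence surjective there by dimension; a preimage of \<open>\<beta>\<close>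
  under \<open>T\<close> is the dual vector.\<close>

lemma dual_vector_ex1:
  assumes X: "X \<in> Rf" and \<beta>: "\<beta> \<in> X"
  shows "\<exists>!v. v \<in> span X \<and> (\<forall>\<gamma>\<in>X. form v \<gamma> = (if \<gamma> = \<beta> then 1 else 0))"
proof (rule ex_ex1I)
  fix v w
  assume *: "v \<in> span X \<and> (\<forall>\<gamma>\<in>X. form v \<gamma> = (if \<gamma> = \<beta> then 1 else 0))"
    "w \<in> span X \<and> (\<forall>\<gamma>\<in>X. form w \<gamma> = (if \<gamma> = \<beta> then 1 else 0))"
  then have "v - w = 0"
    by (intro Rf_form_nondegenerate[OF X]) (auto simp: form_simps span_diff)
  then show "v = w" by simp
next
  note fin = Rf_finite[OF X] and indep = Rf_independent[OF X]
  define T where "T v = (\<Sum>\<gamma>\<in>X. form v \<gamma> *\<^sub>R \<gamma>)" for v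
  have T: "linear T"
    unfolding T_def
    by (rule linearI) (simp_all add: form_simps scaleR_left_distrib sum.distrib scaleR_sum_right)
  have inj: "inj_on T (span X)"
  proof (rule inj_onI)
    fix v w assume vw: "v \<in> span X" "w \<in> span X" "T v = T w"
    then have "(\<Sum>\<gamma>\<in>X. form (v - w) \<gamma> *\<^sub>R \<gamma>) = 0"
      using linear_diff[OF T, of v w] by (simp add: T_def)
    then have "form (v - w) \<gamma> = 0" if "\<gamma> \<in> X" for \<gamma>
      using independentD[OF indep fin order_refl _ that] by blast
    then have "v - w = 0"
      using vw by (intro Rf_form_nondegenerate[OF X] span_diff) auto
    then show "v = w" by simp
  qed
  have indep_T: "independent (T ` X)"
    by (rule linear_independent_injective_image[OF T indep inj])
  have card_T: "card (T ` X) = card X"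
    by (rule card_image[OF inj_on_subset[OF inj span_superset]])
  have "T v \<in> span X" for v
    unfolding T_def by (rule span_sum, rule span_scale, erule span_base)
  then have T_span: "T ` X \<subseteq> span X"
    by blast
  \<comment> \<open>The dimension count: otherwise \<open>\<beta>\<close> together with
    \<open>T\<close> applied to \<open>X\<close> would be an independent set in
    \<open>span X\<close> with one element more than the spanning set \<open>X\<close>.\<close>
  have "\<beta> \<in> span (T ` X)"
  proof (rule ccontr)
    assume \<beta>_T: "\<beta> \<notin> span (T ` X)"
    then have "\<beta> \<notin> T ` X"
      by (rule contrapos_nn) (rule span_base)
    then have "card (insert \<beta> (T ` X)) = Suc (card X)"
      using fin card_T by simp
    moreover have "insert \<beta> (T ` X) \<subseteq> span X"
      using T_span span_base[OF \<beta>] by simp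
    then have "card (insert \<beta> (T ` X)) \<le> card X"
      using independent_span_bound[OF fin independent_insertI[OF \<beta>_T indep_T]] by simp
    ultimately show False by simp
  qed
  then obtain v where v: "v \<in> span X" "T v = \<beta>"
    unfolding linear_span_image[OF T] by blast
  have "(\<Sum>\<gamma>\<in>X. (if \<gamma> = \<beta> then 1 else 0) *\<^sub>R \<gamma>) = (\<Sum>\<gamma>\<in>X. if \<gamma> = \<beta> then \<gamma> else 0)"
    by (intro sum.cong) auto
  then have "(\<Sum>\<gamma>\<in>X. (if \<gamma> = \<beta> then 1 else 0) *\<^sub>R \<gamma>) = \<beta>"
    using fin \<beta> by simp
  then have "(\<Sum>\<gamma>\<in>X. (form v \<gamma> - (if \<gamma> = \<beta> then 1 else 0)) *\<^sub>R \<gamma>) = 0"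
    using v(2) by (simp add: T_def scaleR_left_diff_distrib sum_subtractf)
  then have "form v \<gamma> - (if \<gamma> = \<beta> then 1 else 0) = 0" if "\<gamma> \<in> X" for \<gamma>
    by (rule independentD[OF indep fin order_refl _ that, where u = "\<lambda>\<gamma>. form v \<gamma> - (if \<gamma> = \<beta> then 1 else 0)"])
  with v(1) show "\<exists>v. v \<in> span X \<and> (\<forall>\<gamma>\<in>X. form v \<gamma> = (if \<gamma> = \<beta> then 1 else 0))"
    by (intro exI[of _ v]) simp
qed

section \<open>Equivariance\<close>

text \<open>If \<open>w\<close> and \<open>s\<close> present a root of \<open>X\<close>, then
  \<open>z w\<close> and \<open>s\<close> present its image, and the reflection becomes the
  conjugate by \<open>z\<close>. The reverse inclusion is the same one for the inverse of
  \<open>z\<close>.\<close>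

lemma R_image:
  assumes z: "z \<in> carrier W"
  shows "R (act z ` X) = W.conjugate z ` R X"
proof -
  have sub: "W.conjugate z ` R X \<subseteq> R (act z ` X)" if z: "z \<in> carrier W" for z X
  proof (clarsimp simp: R_def)
    fix w s assume ws: "w \<in> carrier W" "s \<in> S" "act w (\<alpha> s) \<in> X"
    then have "W.conjugate z (w \<otimes>\<^bsub>W\<^esub> gen s \<otimes>\<^bsub>W\<^esub> inv\<^bsub>W\<^esub> w)
        = (z \<otimes>\<^bsub>W\<^esub> w) \<otimes>\<^bsub>W\<^esub> gen s \<otimes>\<^bsub>W\<^esub> inv\<^bsub>W\<^esub> (z \<otimes>\<^bsub>W\<^esub> w)"
      using z by (simp add: W.conjugate_def W.m_assoc W.inv_mult_group)
    then show "\<exists>w' s'. W.conjugate z (w \<otimes>\<^bsub>W\<^esub> gen s \<otimes>\<^bsub>W\<^esub> inv\<^bsub>W\<^esub> w)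
        = w' \<otimes>\<^bsub>W\<^esub> gen s' \<otimes>\<^bsub>W\<^esub> inv\<^bsub>W\<^esub> w' \<and> w' \<in> carrier W \<and> s' \<in> S \<and> act w' (\<alpha> s') \<in> act z ` X"
      using z ws by (intro exI[of _ "z \<otimes>\<^bsub>W\<^esub> w"] exI[of _ s]) (simp add: act_mult)
  qed
  show ?thesis
  proof (intro subset_antisym subsetI)
    fix r assume r: "r \<in> R (act z ` X)"
    then have "r \<in> carrier W"
      using R_closed by blast
    then have "r = W.conjugate z (W.conjugate (inv\<^bsub>W\<^esub> z) r)"
      using z by (simp add: W.conjugate_def flip: W.m_assoc) (simp add: W.m_assoc)
    moreover have "W.conjugate (inv\<^bsub>W\<^esub> z) r \<in> R X"
      using sub[of "inv\<^bsub>W\<^esub> z" "act z ` X"] z r by auto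
    ultimately show "r \<in> W.conjugate z ` R X"
      by (rule image_eqI)
  qed (use sub[OF z] in blast)
qed

lemma W_sub_image: "z \<in> carrier W \<Longrightarrow> W_sub (act z ` X) = W.conjugate z ` W_sub X"
  by (simp add: W_sub_def R_image W.generate_conjugate R_closed)

lemma almost_parabolic_image:
  assumes z: "z \<in> carrier W" and X: "almost_parabolic X"
  shows "almost_parabolic (act z ` X)"
  unfolding almost_parabolic_def
proof (intro conjI ballI)
  show "act z ` X \<subseteq> roots"
    using X z by (auto simp: almost_parabolic_def act_root)
  show "independent (act z ` X)"
    using X linear_independent_injective_image[OF linear_act[OF z]] inj_act[OF z]
    by (auto simp: almost_parabolic_def intro: inj_on_subset)
  fix \<beta> \<gamma> assume "\<beta> \<in> act z ` X" "\<gamma> \<in> act z ` X"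
  then obtain \<beta>' \<gamma>' where bg: "\<beta>' \<in> X" "\<gamma>' \<in> X" "\<beta> = act z \<beta>'" "\<gamma> = act z \<gamma>'"
    by blast
  then obtain w s t where "w \<in> carrier W" "s \<in> S" "t \<in> S" "\<beta>' = act w (\<alpha> s)" "\<gamma>' = act w (\<alpha> t)"
    using X unfolding almost_parabolic_def by metis
  with bg z show "\<exists>w\<in>carrier W. \<exists>s\<in>S. \<exists>t\<in>S. \<beta> = act w (\<alpha> s) \<and> \<gamma> = act w (\<alpha> t)"
    by (intro bexI[of _ "z \<otimes>\<^bsub>W\<^esub> w"] bexI[of _ s] bexI[of _ t]) (simp_all add: act_mult)
qed

lemma Rf_image: "z \<in> carrier W \<Longrightarrow> X \<in> Rf \<Longrightarrow> act z ` X \<in> Rf"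
  by (simp add: Rf_def almost_parabolic_image W_sub_image)

lemma Rf_subset:
  assumes "X \<in> Rf" "Y \<subseteq> X"
  shows "Y \<in> Rf"
proof -
  have "W_sub Y \<subseteq> W_sub X"
    unfolding W_sub_def using assms(2) by (intro W.mono_generate) (auto simp: R_def)
  then show ?thesis
    using assms independent_mono[of X Y] finite_subset
    by (auto simp: Rf_def almost_parabolic_def subset_iff)
qed

text \<open>By invariance of the form and injectivity of \<open>act z\<close>, the moved vector
  satisfies the conditions that characterize the dual vector for the moved set; uniqueness there
  concludes.\<close>

lemma dual_vector_image:
  assumes z: "z \<in> carrier W" and X: "X \<in> Rf" and \<beta>: "\<beta> \<in> X"
  shows "dual_vector (act z ` X) (act z \<beta>) = act z (dual_vector X \<beta>)"
proof -
  define v where "v = dual_vector X \<beta>"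
  have v: "v \<in> span X" "\<forall>\<gamma>\<in>X. form v \<gamma> = (if \<gamma> = \<beta> then 1 else 0)"
    using theI'[OF dual_vector_ex1[OF X \<beta>]] by (simp_all add: v_def dual_vector_def)
  have "form (act z v) (act z \<gamma>) = (if act z \<gamma> = act z \<beta> then 1 else 0)" if "\<gamma> \<in> X" for \<gamma>
  proof -
    have "form (act z v) (act z \<gamma>) = form v \<gamma>"
      using keys_span[OF Rf_roots[OF X] v(1)] keys_root[of \<gamma>] Rf_roots[OF X] that
      by (intro form_act z) auto
    then show ?thesis
      using v(2) that inj_eq[OF inj_act[OF z]] by simp
  qed
  moreover have "act z v \<in> span (act z ` X)"
    using v(1) linear_span_image[OF linear_act[OF z]] by blast
  ultimately show ?thesis
    unfolding dual_vector_def v_def[unfolded dual_vector_def, symmetric]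
    by (intro the1_equality dual_vector_ex1 Rf_image z X imageI \<beta>) auto
qed

lemma base_point_image:
  assumes z: "z \<in> carrier W" and X: "X \<in> Rf"
  shows "base_point (act z ` X) = act z (base_point X)"
proof -
  have "base_point (act z ` X) = (\<Sum>\<beta>\<in>X. dual_vector (act z ` X) (act z \<beta>))"
    unfolding base_point_def using inj_act[OF z]
    by (simp add: sum.reindex inj_on_subset)
  then show ?thesis
    by (simp add: base_point_def dual_vector_image[OF z X] linear_sum[OF linear_act[OF z]])
qed

text \<open>The conjugate of \<open>g\<close> by \<open>z\<close>, applied to the moved base point,
  is \<open>z\<close> applied to \<open>g\<close> of the old one, and linear maps commute with
  convex hulls. Polytopes are the case where \<open>A\<close> is \<open>W_sub X\<close>, faces the
  case of a left coset of \<open>W_sub Y\<close>.\<close>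

lemma orbit_hull_image:
  assumes z: "z \<in> carrier W" and X: "X \<in> Rf" and A: "A \<subseteq> carrier W"
  shows "convex hull {act g (base_point (act z ` X)) | g. g \<in> W.conjugate z ` A}
    = act z ` (convex hull {act g (base_point X) | g. g \<in> A})"
proof -
  have "act (W.conjugate z g) (base_point (act z ` X)) = act z (act g (base_point X))" if "g \<in> A" for g
    using that A z by (auto simp: base_point_image[OF z X] W.conjugate_def act_mult subset_iff)
  then have "{act g (base_point (act z ` X)) | g. g \<in> W.conjugate z ` A}
      = act z ` {act g (base_point X) | g. g \<in> A}"
    by force
  then show ?thesis
    by (simp add: convex_hull_linear_image[OF linear_act[OF z]])
qed

lemma polytope_image:
  assumes "z \<in> carrier W" "X \<in> Rf"
  shows "polytope (act z ` X) = act z ` polytope X"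
  using orbit_hull_image[OF assms W_sub_closed] assms(1) by (simp add: polytope_def W_sub_image)

lemma face_image:
  assumes z: "z \<in> carrier W" and X: "X \<in> Rf" and u: "u \<in> carrier W"
  shows "face (W.conjugate z u) (act z ` Y) (act z ` X) = act z ` face u Y X"
proof -
  have face: "face u Y X = convex hull {act g (base_point X) | g. g \<in> (\<otimes>\<^bsub>W\<^esub>) u ` W_sub Y}" for u Y X
    unfolding face_def by (intro arg_cong[where f = "\<lambda>A. convex hull A"]) blast
  have "(\<otimes>\<^bsub>W\<^esub>) (W.conjugate z u) ` W_sub (act z ` Y) = W.conjugate z ` (\<otimes>\<^bsub>W\<^esub>) u ` W_sub Y"
    unfolding W_sub_image[OF z] image_image
    using z u W_sub_closed by (intro image_cong HOL.refl) (auto simp: W.conjugate_mult subset_iff)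
  moreover have "(\<otimes>\<^bsub>W\<^esub>) u ` W_sub Y \<subseteq> carrier W"
    using u W_sub_closed by auto
  ultimately show ?thesis
    unfolding face by (simp only: orbit_hull_image[OF z X])
qed

text \<open>Conjugation by \<open>z\<close> carries \<open>R X\<close> to the reflections of the
  moved set, so it preserves word lengths, and it carries the coset of \<open>u\<close> to the coset
  of its conjugate.\<close>

lemma minimal_image:
  assumes z: "z \<in> carrier W" and u: "minimal X Y u"
  shows "minimal (act z ` X) (act z ` Y) (W.conjugate z u)"
proof -
  have uX: "u \<in> W_sub X" and min: "\<And>y. y \<in> W_sub Y \<Longrightarrow>
      word_length_in W (R X) u \<le> word_length_in W (R X) (u \<otimes>\<^bsub>W\<^esub> y)"
    using u by (auto simp: minimal_def l_coset_def)
  have length: "word_length_in W (R (act z ` X)) (W.conjugate z g) = word_length_in W (R X) g"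
    if "g \<in> carrier W" for g
    unfolding R_image[OF z]
    by (intro word_length_in_image W.is_group W.conjugate_hom W.conjugate_inj R_closed z that)
  show ?thesis
    unfolding minimal_def
  proof (intro conjI ballI)
    show "W.conjugate z u \<in> W_sub (act z ` X)"
      using uX by (simp add: W_sub_image[OF z])
    fix v assume "v \<in> W.conjugate z u <#\<^bsub>W\<^esub> W_sub (act z ` Y)"
    then obtain y where y: "y \<in> W_sub Y" "v = W.conjugate z u \<otimes>\<^bsub>W\<^esub> W.conjugate z y"
      by (auto simp: l_coset_def W_sub_image[OF z])
    have c: "u \<in> carrier W" "y \<in> carrier W"
      using uX y(1) W_sub_closed by auto
    then have "v = W.conjugate z (u \<otimes>\<^bsub>W\<^esub> y)"
      using y(2) z by (simp add: W.conjugate_mult)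
    then show "word_length_in W (R (act z ` X)) (W.conjugate z u) \<le> word_length_in W (R (act z ` X)) v"
      using min[OF y(1)] c by (simp add: length)
  qed
qed

section \<open>The exchange of the two gluings\<close>

definition cell_map where
  "cell_map = (\<lambda>(z, X). (inv\<^bsub>W\<^esub> z, act z ` X))"

lemma psubset_act_image: "z \<in> carrier W \<Longrightarrow> Y \<subset> X \<Longrightarrow> act z ` Y \<subset> act z ` X"
  by (metis act_inv_image image_mono psubset_eq)

text \<open>With \<open>?u\<close> the conjugate of \<open>u\<close> by \<open>z\<close>, both
  \<open>z u\<close> and \<open>?u z\<close> equal \<open>w\<close>. Hence \<open>w\<close> undoes
  the rotation by the inverse of \<open>u\<close> in \<open>y\<close>: the point \<open>x\<close>
  contributes \<open>z x\<close>, and the shift becomes \<open>?u\<close> applied to the difference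
  of the moved base points.\<close>

lemma Sigma_gluing_image:
  assumes "(((z, X), x), ((w, Y), y)) \<in> Sigma_gluing"
  shows "((cell_map (z, X), act z x), (cell_map (w, Y), act w y)) \<in> Omega_gluing"
proof -
  obtain u where z: "z \<in> carrier W" and X: "X \<in> Rf" and YX: "Y \<subset> X" and u: "minimal X Y u"
    and x: "x \<in> face u Y X" and w: "w = z \<otimes>\<^bsub>W\<^esub> u"
    and y: "y = act (inv\<^bsub>W\<^esub> u) x + base_point Y - base_point X"
    using assms by (auto simp: Sigma_gluing_def)
  have uW: "u \<in> carrier W"
    using u W_sub_closed by (auto simp: minimal_def)
  have Y: "Y \<in> Rf"
    using Rf_subset[OF X] YX by blast
  let ?u = "W.conjugate z u"
  have "inv\<^bsub>W\<^esub> w = inv\<^bsub>W\<^esub> z \<otimes>\<^bsub>W\<^esub> inv\<^bsub>W\<^esub> ?u"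
    using z uW by (simp add: w W.conjugate_def W.inv_mult_group W.m_assoc[symmetric])
  moreover have uz: "act ?u (act z v) = act w v" for v
    using z uW by (simp add: w W.conjugate_def act_mult)
  then have "act w ` Y = act ?u ` act z ` Y"
    by (simp add: image_image)
  moreover have "act w y = act z x + act ?u (base_point (act z ` Y) - base_point (act z ` X))"
    unfolding base_point_image[OF z X] base_point_image[OF z Y] y
    using z uW
    by (simp add: uz[symmetric] linear_diff[OF linear_act] linear_add[OF linear_act])
      (simp add: uz w act_mult)
  moreover have "act z x \<in> face ?u (act z ` Y) (act z ` X)"
    using x by (simp add: face_image[OF z X uW])
  ultimately show ?thesis
    unfolding cell_map_def Omega_gluing_def prod.case
    by (intro CollectI exI[of _ "inv\<^bsub>W\<^esub> z"] exI[of _ "act z ` X"] exI[of _ ?u]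
        exI[of _ "act z ` Y"] exI[of _ "act z x"] conjI)
      (simp_all only: W.inv_closed z Rf_image[OF z X] psubset_act_image[OF z YX] minimal_image[OF z u])
qed

text \<open>Here \<open>w\<close> is \<open>z\<close> times the inverse of \<open>u\<close>, so it
  cancels the \<open>u\<close> in front of both the roots and the shift. The remaining rotation of
  \<open>x\<close> reappears as the inverse of \<open>?u\<close> applied to \<open>z x\<close>, as
  the other prescription demands.\<close>

lemma Omega_gluing_image:
  assumes "(((z, X), x), ((w, Y), y)) \<in> Omega_gluing"
  shows "((cell_map (z, X), act z x), (cell_map (w, Y), act w y)) \<in> Sigma_gluing"
proof -
  obtain u Y' where z: "z \<in> carrier W" and X: "X \<in> Rf" and YX: "Y' \<subset> X" and u: "minimal X Y' u"
    and x: "x \<in> face u Y' X" and w: "w = z \<otimes>\<^bsub>W\<^esub> inv\<^bsub>W\<^esub> u" and YY': "Y = act u ` Y'"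
    and y: "y = x + act u (base_point Y' - base_point X)"
    using assms by (auto simp: Omega_gluing_def)
  have uW: "u \<in> carrier W"
    using u W_sub_closed by (auto simp: minimal_def)
  have Y: "Y' \<in> Rf"
    using Rf_subset[OF X] YX by blast
  let ?u = "W.conjugate z u"
  have "inv\<^bsub>W\<^esub> w = inv\<^bsub>W\<^esub> z \<otimes>\<^bsub>W\<^esub> ?u"
    using z uW by (simp add: w W.conjugate_def W.inv_mult_group W.m_assoc[symmetric])
  moreover have "act w ` Y = act z ` Y'"
    using z uW by (simp add: w YY' image_image act_mult)
  moreover have "act w y = act (inv\<^bsub>W\<^esub> ?u) (act z x) + base_point (act z ` Y') - base_point (act z ` X)"
    unfolding base_point_image[OF z X] base_point_image[OF z Y] y
    using z uW
    by (simp add: w W.conjugate_def W.inv_mult_group act_mult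
        linear_diff[OF linear_act] linear_add[OF linear_act])
  moreover have "act z x \<in> face ?u (act z ` Y') (act z ` X)"
    using x by (simp add: face_image[OF z X uW])
  ultimately show ?thesis
    unfolding cell_map_def Sigma_gluing_def prod.case
    by (intro CollectI exI[of _ "inv\<^bsub>W\<^esub> z"] exI[of _ "act z ` X"] exI[of _ ?u]
        exI[of _ "act z ` Y'"] exI[of _ "act z x"] conjI)
      (simp_all only: W.inv_closed z Rf_image[OF z X] psubset_act_image[OF z YX] minimal_image[OF z u])
qed

theorem cellular_isomorphism_Sigma_Omega: "\<exists>f. cellular_isomorphism Sigma_bar Omega_bar f"
  unfolding Sigma_bar_def Omega_bar_def
\<comment> \<open>The same data serve as the map and as its inverse; the two conditions on
  generating pairs are therefore the two exchange lemmas.\<close>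
proof (rule cellular_isomorphism_glued_complex[where \<sigma> = cell_map and \<tau> = cell_map
      and h = "\<lambda>(z, X). act z" and k = "\<lambda>(z, X). act z"], goal_cases)
  case (5 i)
  then show ?case
    by (auto simp: linear_continuous_on bounded_linear_act)
next
  case (8 i)
  then show ?case
    by (auto simp: linear_continuous_on bounded_linear_act)
next
  case (9 i)
  obtain z X where i: "i = (z, X)" by (cases i)
  with 9 have z: "z \<in> carrier W" and X: "X \<in> Rf" by auto
  have "rel_interior (act z ` polytope X) = act z ` rel_interior (polytope X)"
    using z by (intro rel_interior_bounded_linear_bij[where g = "act (inv\<^bsub>W\<^esub> z)"] bounded_linear_act) auto
  then show ?case
    by (simp add: i cell_map_def polytope_image[OF z X])
next
  case (10 i)
  then show ?case
    using inj_act by (auto simp: cell_map_def intro!: card_image intro: inj_on_subset)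
next
  case (11 i x j y)
  then show ?case
    by (cases i; cases j) (simp add: Sigma_gluing_image)
next
  case (12 i x j y)
  then show ?case
    by (cases i; cases j) (simp add: Omega_gluing_image)
qed (auto simp: cell_map_def Rf_image polytope_image)

end

theorem theorem5p17:
  fixes S :: "'s set" and m :: "'s \<Rightarrow> 's \<Rightarrow> enat"
  assumes "coxeter_graph S m"
  shows "\<exists>f. cellular_isomorphism (coxeter_graph.Sigma_bar S m) (coxeter_graph.Omega_bar S m) f"
  using assms by (rule coxeter_graph.cellular_isomorphism_Sigma_Omega)

end
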